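(* Let $\Omega=\mathbb{R}^N_+$, $N\ge2$, and $\varphi_b\equiv0$. There is $\varphi\in L^\infty(\Omega)$ such that for every $x_0>0$ there is $\tau_2>0$ such that for every compact set $K\subset\mathbb{R}^{N-1}\times(x_0,\infty)\times(0,\tau_2)$ there are $\varepsilon_0\in(0,1]$ and $C>0$ such that the global-in-time solution $u_\varepsilon=v_\varepsilon+w_\varepsilon$ (see context) with data $\varphi$ and $\varphi_b\equiv 0$ satisfies $$u_\varepsilon(x,t)-[S_2(t)\varphi_b](x)=u_\varepsilon(x,t)\ge C\sqrt{\varepsilon}$$ for every $\varepsilon\in(0,\varepsilon_0)$ and every $(x,t)\in K$.
   Context: Setting: $\Omega=\mathbb{R}^N_+=\mathbb{R}^{N-1}\times(0,\infty)$, points $x=(x',x_N)$; $\partial\Omega$ is identified with $\mathbb{R}^{N-1}$; $\partial_\nu=-\partial_{x_N}$ (on all of $\overline\Omega$). For $\varepsilon\in(0,1)$ the problem is $$\varepsilon\partial_tu_\varepsilon-\Delta u_\varepsilon=0\ \text{in }\Omega\times(0,\infty),\quad \partial_tu_\varepsilon+\partial_\nu u_\varepsilon=0\ \text{on }\partial\Omega\times(0,\infty),\quad u_\varepsilon(\cdot,0)=\varphi\ \text{in }\Omega,\quad u_\varepsilon(\cdot,0)=\varphi_b\ \text{on }\partial\Omega.$$ Dirichlet heat semigroup: with $y_*=(y',-y_N)$, $$[S_1(t)\phi](x)=(4\pi t)^{-N/2}\int_{\mathbb{R}^N_+}\Big(e^{-\frac{|x-y|^2}{4t}}-e^{-\frac{|x-y_*|^2}{4t}}\Big)\phi(y)\,dy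 .$$ Harmonic functions with dynamical boundary condition: for $\psi\in L^\infty(\partial\Omega)$, $$[S_2(t)\psi](x)=\frac{\Gamma(N/2)}{\pi^{N/2}}\int_{\mathbb{R}^{N-1}}(x_N+t)^{1-N}\Big(1+\frac{|x'-y'|^2}{(x_N+t)^2}\Big)^{-N/2}\psi(y')\,dy',$$ so that $p(t)=S_2(t)\psi$ solves $-\Delta p=0$ in $\Omega$, $\partial_tp+\partial_\nu p=0$ on $\partial\Omega$, $p(\cdot,0)=\psi$ on $\partial\Omega$. Solution: put $\Phi=\varphi-S_2(0)\varphi_b$. A pair $(v_\varepsilon,w_\varepsilon)$ with $v_\varepsilon,\partial_\nu v_\varepsilon,w_\varepsilon\in C(\overline\Omega\times(0,\infty))$ is a global-in-time solution if for $x\in\Omega$, $t>0$ $$w_\varepsilon(x,t)=[S_2(t)\varphi_b](x)-\int_0^t[S_2(t-s)\,\partial_\nu v_\varepsilon|_{\partial\Omega}(\cdot,s)](x)\,ds,$$ $$v_\varepsilon(x,t)=[S_1(t/\varepsilon)\Phi](x)-\int_0^t[S_1((t-s)/\varepsilon)\,\partial_tw_\varepsilon(\cdot,s)](x)\,ds,$$ where $\partial_tw_\varepsilon=F_1[\varphi_b]+F_2[v_\varepsilon]$ with $F_1[\varphi_b](x,t)=\partial_t[S_2(t)\varphi_b](x)$ and $$F_2[v](x,t)=-[S_2(0)\,\partial_\nu v|_{\partial\Omega}(\cdot,t)](x)-\int_0^t\partial_t[S_2(t-s)\,\partial_\nu v|_{\partial\Omega}(\cdot,s)](x)\,ds.$$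 Known fact (prior work): for every $\varepsilon\in(0,1)$, $\varphi\in L^\infty(\Omega)$, $\varphi_b\in L^\infty(\partial\Omega)$ there is a unique global-in-time solution $(v_\varepsilon,w_\varepsilon)$ such that $\sup_{0<t<T}\big(\|v_\varepsilon(\cdot,t)\|_{L^\infty(\Omega)}+\sqrt{t/\varepsilon}\,\|\partial_\nu v_\varepsilon(\cdot,t)\|_{L^\infty(\Omega)}+\|w_\varepsilon(\cdot,t)\|_{L^\infty(\Omega)}\big)<\infty$ for every $T>0$, and this supremum is bounded by $C(T)(\|\varphi\|_{L^\infty(\Omega)}+\|\varphi_b\|_{L^\infty(\partial\Omega)})$ with $C(T)$ independent of $\varepsilon$, $\varphi$, $\varphi_b$. The function $u_\varepsilon:=v_\varepsilon+w_\varepsilon$ in the claim is built from this solution. *)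

theory Defs
  imports "HOL-Analysis.Analysis" "HOL-Probability.Essential_Supremum"
begin

text \<open>
  Points of $\mathbb{R}^N$ are pairs $x = (x', x_N)$ of type \<open>(real^'n) \<times> real\<close>, so
  $N = \mathrm{CARD}('n) + 1 = \mathrm{DIM}(\mathtt{real^'n \times real})$ ranges over all
  integers $N \ge 2$. The boundary $\partial\Omega$ is identified with \<open>real^'n\<close>.
\<close>

definition halfspace :: "((real^'n) \<times> real) set" where
  "halfspace = UNIV \<times> {0<..}"

definition Linf_norm :: "'a::euclidean_space set \<Rightarrow> ('a \<Rightarrow> real) \<Rightarrow> ereal" where
  "Linf_norm A f = esssup (lebesgue_on A) (\<lambda>x. ereal \<bar>f x\<bar>)"

definition Linf :: "'a::euclidean_space set \<Rightarrow> ('a \<Rightarrow> real) set" where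
  "Linf A = {f. f \<in> borel_measurable (lebesgue_on A) \<and> Linf_norm A f < \<infinity>}"

definition reflect :: "(real^'n) \<times> real \<Rightarrow> (real^'n) \<times> real" where
  "reflect y = (fst y, - snd y)"

definition S1 :: "real \<Rightarrow> ((real^'n) \<times> real \<Rightarrow> real) \<Rightarrow> (real^'n) \<times> real \<Rightarrow> real" where
  "S1 t \<phi> x =
     (4 * pi * t) powr (- real DIM((real^'n) \<times> real) / 2) *
     (LINT y|lebesgue_on halfspace.
        (exp (- (norm (x - y))\<^sup>2 / (4 * t)) - exp (- (norm (x - reflect y))\<^sup>2 / (4 * t))) * \<phi> y)"

definition S2 :: "real \<Rightarrow> (real^'n \<Rightarrow> real) \<Rightarrow> (real^'n) \<times> real \<Rightarrow> real" where
  "S2 t \<psi> x =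
     (let N = real DIM((real^'n) \<times> real) in
      Gamma (N / 2) / pi powr (N / 2) *
      (LINT y|lebesgue.
         (snd x + t) powr (1 - N) *
         (1 + (norm (fst x - y))\<^sup>2 / (snd x + t)\<^sup>2) powr (- N / 2) * \<psi> y))"

text \<open>
  The derivative $\partial_\nu = -\partial_{x_N}$ on $\overline\Omega$; it is one-sided at
  points with $x_N = 0$.
\<close>

definition dnu :: "((real^'n) \<times> real \<Rightarrow> real) \<Rightarrow> (real^'n) \<times> real \<Rightarrow> real" where
  "dnu f x = - vector_derivative (\<lambda>r. f (fst x, r)) (at (snd x) within {0..})"

definition dnu_bdry ::
  "((real^'n) \<times> real \<Rightarrow> real \<Rightarrow> real) \<Rightarrow> real \<Rightarrow> real^'n \<Rightarrow> real" where
  "dnu_bdry v t y = dnu (\<lambda>x. v x t) (y, 0)"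

definition F1 :: "(real^'n \<Rightarrow> real) \<Rightarrow> (real^'n) \<times> real \<Rightarrow> real \<Rightarrow> real" where
  "F1 \<phi>b x t = deriv (\<lambda>r. S2 r \<phi>b x) t"

definition F2 ::
  "((real^'n) \<times> real \<Rightarrow> real \<Rightarrow> real) \<Rightarrow> (real^'n) \<times> real \<Rightarrow> real \<Rightarrow> real" where
  "F2 v x t =
     - S2 0 (dnu_bdry v t) x
     - (LINT s|lebesgue_on {0<..<t}. deriv (\<lambda>r. S2 (r - s) (dnu_bdry v s) x) t)"

text \<open>
  Only the values of \<open>v\<close> and \<open>w\<close> at points of $\overline\Omega$ and times $t > 0$ matter.
  The function $\partial_t w$ in the equation for \<open>v\<close> is, by convention, \<open>F1 \<phi>b + F2 v\<close>.
\<close>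

definition global_solution ::
  "real \<Rightarrow> ((real^'n) \<times> real \<Rightarrow> real) \<Rightarrow> (real^'n \<Rightarrow> real) \<Rightarrow>
   ((real^'n) \<times> real \<Rightarrow> real \<Rightarrow> real) \<Rightarrow> ((real^'n) \<times> real \<Rightarrow> real \<Rightarrow> real) \<Rightarrow> bool" where
  "global_solution \<epsilon> \<phi> \<phi>b v w \<longleftrightarrow>
     continuous_on (closure halfspace \<times> {0<..}) (\<lambda>(x, t). v x t) \<and>
     (\<forall>x\<in>closure halfspace. \<forall>t>0.
        (\<lambda>r. v (fst x, r) t) differentiable (at (snd x) within {0..})) \<and>
     continuous_on (closure halfspace \<times> {0<..}) (\<lambda>(x, t). dnu (\<lambda>z. v z t) x) \<and>
     continuous_on (closure halfspace \<times> {0<..}) (\<lambda>(x, t). w x t) \<and>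
     (\<forall>x\<in>halfspace. \<forall>t>0.
        w x t = S2 t \<phi>b x - (LINT s|lebesgue_on {0<..<t}. S2 (t - s) (dnu_bdry v s) x)) \<and>
     (\<forall>x\<in>halfspace. \<forall>t>0.
        v x t = S1 (t / \<epsilon>) (\<lambda>y. \<phi> y - S2 0 \<phi>b y) x
              - (LINT s|lebesgue_on {0<..<t}. S1 ((t - s) / \<epsilon>) (\<lambda>y. F1 \<phi>b y s + F2 v y s) x))"

text \<open>
  The class in which the global-in-time solution is unique. For \<open>\<phi>\<close>, \<open>\<phi>b\<close> in $L^\infty$ and a
  pair that is continuous as in \<open>global_solution\<close>, these bounds make all integrals in
  \<open>global_solution\<close> absolutely convergent, so the default value of the integral of a
  non-integrable function plays no role.
\<close>

definition bounded_class ::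
  "real \<Rightarrow> ((real^'n) \<times> real \<Rightarrow> real \<Rightarrow> real) \<Rightarrow> ((real^'n) \<times> real \<Rightarrow> real \<Rightarrow> real) \<Rightarrow> bool" where
  "bounded_class \<epsilon> v w \<longleftrightarrow>
     (\<forall>T>0. (SUP t\<in>{0<..<T}.
        Linf_norm halfspace (\<lambda>x. v x t)
        + ereal (sqrt (t / \<epsilon>)) * Linf_norm halfspace (dnu (\<lambda>x. v x t))
        + Linf_norm halfspace (\<lambda>x. w x t)) < \<infinity>)"

end

theory Submission
  imports Defs
begin

text \<open>
  Take \<open>\<phi> = 1\<close> and any \<open>\<tau>2 \<le> 1\<close>. Write \<open>g\<close> for the boundary flux \<open>\<partial>\<^sub>\<nu> v\<close>, so that
  \<open>w(t) = - \<integral>\<^sub>0\<^sup>t S\<^sub>2(t - s) g(s) ds\<close>. The term \<open>S\<^sub>1(t/\<epsilon>) 1\<close> in the equation for \<open>v\<close>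
  contributes a negative amount of exact order \<open>\<epsilon>\<^sup>1\<^sup>/\<^sup>2 t\<^sup>-\<^sup>1\<^sup>/\<^sup>2\<close> to \<open>g\<close>. If
  \<open>|g(s)| \<le> M s\<^sup>-\<^sup>1\<^sup>/\<^sup>2\<close>, then \<open>|F\<^sub>2[v](x,s)|\<close> is at most a constant times
  \<open>M (s\<^sup>-\<^sup>1\<^sup>/\<^sup>2 + x\<^sub>N\<^sup>-\<^sup>1\<^sup>/\<^sup>2)\<close>, and the Duhamel term in \<open>v\<close> is \<open>O(\<epsilon>\<^sup>1\<^sup>/\<^sup>2 M x\<^sub>N)\<close>.
  Dividing by \<open>x\<^sub>N \<rightarrow> 0\<close> bounds \<open>g\<close> again; as \<open>M\<close> is finite, the estimate absorbs it for
  small \<open>\<epsilon>\<close> and yields \<open>M = O(\<epsilon>\<^sup>1\<^sup>/\<^sup>2)\<close>. The Duhamel term is then \<open>O(\<epsilon>)\<close>, whereas \<open>w\<close> is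
  bounded below by a multiple of \<open>(\<epsilon> t)\<^sup>1\<^sup>/\<^sup>2\<close>. Only the scaling of the kernels enters, so their masses are
  left as unevaluated constants.
\<close>

section \<open>Integration in Euclidean space\<close>

text \<open>
  No integrability of \<open>f\<close>: otherwise its integral is the default value 0. This avoids all
  measurability questions about \<open>F\<^sub>2[v]\<close>.
\<close>

lemma abs_integral_le_integral:
  fixes f g :: "'a \<Rightarrow> real"
  assumes "\<And>x. x \<in> space M \<Longrightarrow> \<bar>f x\<bar> \<le> g x" "integrable M g"
  shows "\<bar>integral\<^sup>L M f\<bar> \<le> integral\<^sup>L M g"
proof (cases "integrable M f")
  case True
  then show ?thesis
    using assms by (intro order_trans[OF integral_abs_bound] integral_mono) auto
next
  case False
  have "0 \<le> integral\<^sup>L M g"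
    using assms(1) by (intro Bochner_Integration.integral_nonneg) (meson abs_ge_zero order_trans)
  then show ?thesis
    using False by (simp add: not_integrable_integral_eq)
qed

text \<open>The operators integrate against \<open>lebesgue_on\<close>, whereas scaling and Fubini
  are carried out in \<open>lborel\<close>. The completion changes neither integrability nor the
  value for a Borel integrand.\<close>

lemma lebesgue_on_borel:
  fixes g :: "'a::euclidean_space \<Rightarrow> real"
  assumes "S \<in> sets borel" and g: "set_integrable lborel S g"
  shows integrable_lebesgue_on_borel: "integrable (lebesgue_on S) g"
    and integral_lebesgue_on_borel: "integral\<^sup>L (lebesgue_on S) g = (LINT x:S|lborel. g x)"
proof -
  have S: "S \<inter> space lebesgue \<in> sets lebesgue"
    using assms(1) by auto
  have m: "(\<lambda>x. indicator S x *\<^sub>R g x) \<in> borel_measurable lborel"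
    using g unfolding set_integrable_def by auto
  show "integrable (lebesgue_on S) g"
    using g m integrable_completion[of "\<lambda>x. indicator S x *\<^sub>R g x" lborel]
    unfolding integrable_restrict_space[OF S] set_integrable_def by auto
  show "integral\<^sup>L (lebesgue_on S) g = (LINT x:S|lborel. g x)"
    unfolding integral_restrict_space[OF S] set_lebesgue_integral_def
    by (rule integral_completion[OF m])
qed

text \<open>Scaling reduces the kernel masses to unit scale: \<open>poisson_mass\<close> and
  \<open>gaussian_mass\<close> use it with a negative factor \<open>c\<close>, which also absorbs
  the reflection in \<open>x - y\<close>.\<close>

lemma lborel_affine_integral:
  fixes f :: "'a::euclidean_space \<Rightarrow> real"
  assumes c: "c \<noteq> 0"
  shows lborel_integrable_affine_iff:
      "integrable lborel (\<lambda>x. f (t + c *\<^sub>R x)) \<longleftrightarrow> integrable lborel f"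
    and lborel_integral_affine:
      "integrable lborel f \<Longrightarrow>
       (\<integral>x. f x \<partial>lborel) = \<bar>c\<bar> ^ DIM('a) * (\<integral>x. f (t + c *\<^sub>R x) \<partial>lborel)"
proof -
  have *: "integrable lborel (\<lambda>x. f (t + c *\<^sub>R x))"
    if c: "c \<noteq> 0" and f: "integrable lborel f" for f :: "'a \<Rightarrow> real" and c t
  proof -
    have "integrable (density (distr lborel borel (\<lambda>x. t + c *\<^sub>R x)) (\<lambda>_. ennreal (\<bar>c\<bar>^DIM('a)))) f"
      using f lborel_affine[OF c, of t] by simp
    then show ?thesis
      using c borel_measurable_integrable[OF f]
      by (simp add: integrable_density integrable_distr_eq)
  qed
  \<comment> \<open>Writing \<open>f\<close> as the rescaled function composed with the inverse map
    turns the one implication \<open>*\<close> into an equivalence.\<close>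
  have f_eq: "f = (\<lambda>x. (\<lambda>x. f (t + c *\<^sub>R x)) ((- t /\<^sub>R c) + (1/c) *\<^sub>R x))"
    using c by (auto simp: fun_eq_iff algebra_simps)
  show "integrable lborel (\<lambda>x. f (t + c *\<^sub>R x)) \<longleftrightarrow> integrable lborel f"
    using *[OF c, of f t] *[of "1/c" "\<lambda>x. f (t + c *\<^sub>R x)" "- t /\<^sub>R c"] f_eq c by auto
  show "(\<integral>x. f x \<partial>lborel) = \<bar>c\<bar> ^ DIM('a) * (\<integral>x. f (t + c *\<^sub>R x) \<partial>lborel)"
    if f: "integrable lborel f"
  proof -
    have m[measurable]: "f \<in> borel_measurable borel"
      using f by auto
    show ?thesis
      by (subst lborel_affine[OF c, of t]) (simp add: integral_density integral_distr)
  qed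
qed

lemma lborel_product_integral:
  fixes f :: "'a::euclidean_space \<Rightarrow> real" and g :: "'b::euclidean_space \<Rightarrow> real"
  assumes f: "integrable lborel f" and g: "integrable lborel g"
  shows lborel_integrable_product: "integrable lborel (\<lambda>p. f (fst p) * g (snd p))"
    and lborel_integral_product:
      "(\<integral>p. f (fst p) * g (snd p) \<partial>lborel) = (\<integral>x. f x \<partial>lborel) * (\<integral>y. g y \<partial>lborel)"
proof -
  have [measurable]: "f \<in> borel_measurable borel" "g \<in> borel_measurable borel"
    using f g by auto
  have i: "integrable (lborel \<Otimes>\<^sub>M lborel) (\<lambda>p. f (fst p) * g (snd p))"
    by (rule lborel_pair.Fubini_integrable) (use f g in \<open>auto simp: abs_mult\<close>)
  then show "integrable lborel (\<lambda>p. f (fst p) * g (snd p))"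
    by (simp add: lborel_prod)
  show "(\<integral>p. f (fst p) * g (snd p) \<partial>lborel) = (\<integral>x. f x \<partial>lborel) * (\<integral>y. g y \<partial>lborel)"
    using lborel_pair.integral_fst'[OF i] by (simp add: lborel_prod)
qed

lemma nn_integral_suminf_indicator:
  fixes c :: "nat \<Rightarrow> ennreal"
  assumes "\<And>k. A k \<in> sets M"
  shows "(\<integral>\<^sup>+z. (\<Sum>k. c k * indicator (A k) z) \<partial>M) = (\<Sum>k. c k * emeasure M (A k))"
proof -
  have "(\<lambda>z. c k * indicator (A k) z) \<in> borel_measurable M" for k
    using assms by measurable
  then have "(\<integral>\<^sup>+z. (\<Sum>k. c k * indicator (A k) z) \<partial>M) = (\<Sum>k. \<integral>\<^sup>+z. c k * indicator (A k) z \<partial>M)"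
    by (rule nn_integral_suminf)
  then show ?thesis
    by (simp only: nn_integral_cmult_indicator[OF assms])
qed

text \<open>Dyadic decomposition: where \<open>2^(k-1) < norm z \<le> 2^k\<close> the integrand is
  at most \<open>?c k\<close>, and the ball of radius \<open>2^k\<close> has volume proportional to
  \<open>2^(k d)\<close> with \<open>d\<close> the dimension. The resulting series is geometric with
  ratio \<open>2^(d - p) < 1\<close>.\<close>

lemma integrable_japanese_bracket:
  fixes p :: real
  assumes p: "p > DIM('a)"
  shows "integrable lborel (\<lambda>z::'a::euclidean_space. (1 + (norm z)\<^sup>2) powr (- p / 2))"
proof -
  let ?f = "\<lambda>z::'a. (1 + (norm z)\<^sup>2) powr (- p / 2)"
  let ?V = "unit_ball_vol (DIM('a))"
  let ?c = "\<lambda>k::nat. 2 powr (p * (1 - real k))"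
  have p0: "p > 0"
    using p by (meson of_nat_0_le_iff le_less_trans)
  have le_suminf: "F k \<le> suminf F" for F :: "nat \<Rightarrow> ennreal" and k
    using sum_le_suminf[of F "{k}"] by simp
  have pt: "ennreal (?f z) \<le> (\<Sum>k. ennreal (?c k) * indicator (cball 0 (2^k)) z)" for z :: 'a
  proof -
    obtain k0 :: nat where "norm z \<le> 2^k0"
      using real_arch_pow[of 2 "norm z"] by (auto intro: less_imp_le)
    \<comment> \<open>The least such \<open>k\<close>: minimality supplies the lower bound on
      \<open>norm z\<close>, and with it the exponent \<open>1 - k\<close> in \<open>?c\<close>. For
      \<open>k = 0\<close> there is no lower bound, but there \<open>?c 0 \<ge> 1\<close>.\<close>
    then obtain k where k: "norm z \<le> 2^k" and min: "\<And>j. j < k \<Longrightarrow> \<not> norm z \<le> 2^j"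
      using exists_least_iff[of "\<lambda>k. norm z \<le> 2^k"] by blast
    have "?f z \<le> ?c k"
    proof (cases k)
      case 0
      have "?f z \<le> 1 powr (-p/2)"
        using p0 by (intro powr_mono2') auto
      also have "1 powr (-p/2) \<le> ?c k"
        using 0 p0 by (auto intro: ge_one_powr_ge_zero)
      finally show ?thesis .
    next
      case (Suc j)
      then have j: "2^j < norm z"
        using min[of j] by simp
      have "(2^j)\<^sup>2 \<le> 1 + (norm z)\<^sup>2"
        using power_mono[of "2^j" "norm z" 2] j by (smt (verit) zero_le_power)
      then have "?f z \<le> ((2^j)\<^sup>2) powr (-p/2)"
        using p0 by (intro powr_mono2') auto
      also have "\<dots> = ?c k"
      proof -
        have "((2::real)^j)\<^sup>2 = 2 powr (2 * real j)"
          by (simp add: powr_realpow[symmetric] powr_add[symmetric] power2_eq_square)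
        then show ?thesis
          using Suc by (simp add: powr_powr algebra_simps)
      qed
      finally show ?thesis .
    qed
    then have "ennreal (?f z) \<le> ennreal (?c k) * indicator (cball 0 (2^k)) z"
      using k by (simp add: ennreal_leI)
    also have "\<dots> \<le> (\<Sum>k. ennreal (?c k) * indicator (cball 0 (2^k)) z)"
      by (rule le_suminf[of "\<lambda>k. ennreal (?c k) * indicator (cball 0 (2^k)) z" k])
    finally show ?thesis .
  qed
  have "(\<integral>\<^sup>+z. ennreal (?f z) \<partial>lborel) \<le> (\<integral>\<^sup>+z. (\<Sum>k. ennreal (?c k) * indicator (cball 0 (2^k)) z) \<partial>(lborel::'a measure))"
    by (intro nn_integral_mono pt)
  also have "\<dots> = (\<Sum>k. ennreal (?c k) * emeasure lborel (cball (0::'a) (2^k)))"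
    by (rule nn_integral_suminf_indicator) simp
  also have "\<dots> = (\<Sum>k. ennreal (2 powr p * ?V * (2 powr (DIM('a) - p)) ^ k))"
  proof (intro suminf_cong)
    fix k
    have "?c k * (2^k)^DIM('a) = 2 powr p * (2 powr (DIM('a) - p)) ^ k"
    proof -
      have "((2::real)^k)^DIM('a) = 2 powr (real k * DIM('a))"
        by (simp flip: power_mult add: powr_realpow[of 2 "k * DIM('a)", simplified])
      moreover have "(2 powr (DIM('a) - p)) ^ k = 2 powr (real k * (DIM('a) - p))"
        by (simp add: powr_power mult.commute)
      ultimately show ?thesis
        by (simp only: powr_add[symmetric]) (simp add: algebra_simps)
    qed
    then show "ennreal (?c k) * emeasure lborel (cball (0::'a) (2^k)) =
        ennreal (2 powr p * ?V * (2 powr (DIM('a) - p)) ^ k)"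
      by (simp add: emeasure_cball ennreal_mult[symmetric] mult_ac)
  qed
  also have "\<dots> < \<infinity>"
  proof -
    have "2 powr (DIM('a) - p) < 2 powr 0"
      using p by (intro powr_less_mono) auto
    then have "summable (\<lambda>k. 2 powr p * ?V * (2 powr (DIM('a) - p)) ^ k)"
      by (intro summable_mult summable_geometric) auto
    then show ?thesis
      by (subst suminf_ennreal2) auto
  qed
  finally show ?thesis
    by (intro integrableI_nonneg) auto
qed

section \<open>The Poisson kernel\<close>

text \<open>Differentiation under the integral sign. The mean value inequality bounds the difference
  quotients by \<open>h\<close>, and dominated convergence applies along every sequence tending to
  \<open>a0\<close>.\<close>

lemma has_real_derivative_integral:
  fixes f f' :: "real \<Rightarrow> 'a \<Rightarrow> real"
  assumes e: "e > 0"
    and f: "\<And>a. a \<in> ball a0 e \<Longrightarrow> integrable M (f a)"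
    and f': "\<And>a y. a \<in> ball a0 e \<Longrightarrow> y \<in> space M \<Longrightarrow>
               ((\<lambda>a. f a y) has_real_derivative f' a y) (at a)"
    and f'_meas: "f' a0 \<in> borel_measurable M"
    and bound: "\<And>a y. a \<in> ball a0 e \<Longrightarrow> y \<in> space M \<Longrightarrow> \<bar>f' a y\<bar> \<le> h y"
    and h: "integrable M h"
  shows "((\<lambda>a. integral\<^sup>L M (f a)) has_real_derivative integral\<^sup>L M (f' a0)) (at a0)"
  unfolding has_field_derivative_iff tendsto_at_iff_sequentially
proof (intro allI impI)
  fix X assume X: "\<forall>i. X i \<in> UNIV - {a0}" "X \<longlonglongrightarrow> a0"
  let ?q = "\<lambda>b y. (f b y - f a0 y) / (b - a0)"
  have a0: "a0 \<in> ball a0 e"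
    using e by simp
  have q_bound: "\<bar>?q b y\<bar> \<le> h y" if b: "b \<in> ball a0 e" "b \<noteq> a0" and y: "y \<in> space M" for b y
  proof -
    have "\<bar>f b y - f a0 y\<bar> \<le> h y * \<bar>b - a0\<bar>"
      using field_differentiable_bound[OF convex_ball, of a0 e "\<lambda>a. f a y" "\<lambda>a. f' a y" "h y" b a0]
        DERIV_subset[OF f'[OF _ y]] bound[OF _ y] a0 b by auto
    then show ?thesis
      using b by (simp add: divide_simps)
  qed
  obtain n0 where n0: "\<And>n. n \<ge> n0 \<Longrightarrow> X n \<in> ball a0 e"
    using topological_tendstoD[OF X(2) open_ball a0] by (auto simp: eventually_sequentially)
  \<comment> \<open>Dropping the first \<open>n0\<close> terms puts the whole sequence into the
    ball, so that domination holds for every index; \<open>LIMSEQ_offset\<close> restores the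
    original sequence.\<close>
  define Y where "Y = (\<lambda>n. X (n + n0))"
  have Y: "Y n \<in> ball a0 e" "Y n \<noteq> a0" for n
    using n0[of "n + n0"] X(1) by (auto simp: Y_def)
  have Y_lim: "filterlim Y (at a0) sequentially"
    unfolding filterlim_at using Y LIMSEQ_ignore_initial_segment[OF X(2), of n0] by (simp add: Y_def)
  have "(\<lambda>n. integral\<^sup>L M (?q (Y n))) \<longlonglongrightarrow> integral\<^sup>L M (f' a0)"
  proof (rule integral_dominated_convergence[OF f'_meas _ h])
    show "?q (Y n) \<in> borel_measurable M" for n
      using f[OF a0] f[OF Y(1)] by measurable
    show "AE y in M. (\<lambda>n. ?q (Y n) y) \<longlonglongrightarrow> f' a0 y"
    proof (rule AE_I2)
      fix y assume "y \<in> space M"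
      from f'[OF a0 this] show "(\<lambda>n. ?q (Y n) y) \<longlonglongrightarrow> f' a0 y"
        unfolding has_field_derivative_iff by (rule filterlim_compose[OF _ Y_lim])
    qed
    show "AE y in M. norm (?q (Y n) y) \<le> h y" for n
      using q_bound[OF Y] by auto
  qed
  moreover have "integral\<^sup>L M (?q (Y n)) =
      (integral\<^sup>L M (f (Y n)) - integral\<^sup>L M (f a0)) / (Y n - a0)" for n
    using f[OF a0] f[OF Y(1)] by (simp only: Bochner_Integration.integral_diff integral_divide_zero)
  ultimately have "(\<lambda>n. ((\<lambda>b. (integral\<^sup>L M (f b) - integral\<^sup>L M (f a0)) / (b - a0)) \<circ> X) (n + n0))
      \<longlonglongrightarrow> integral\<^sup>L M (f' a0)"
    by (simp only: Y_def comp_def)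
  then show "((\<lambda>b. (integral\<^sup>L M (f b) - integral\<^sup>L M (f a0)) / (b - a0)) \<circ> X)
      \<longlonglongrightarrow> integral\<^sup>L M (f' a0)"
    by (rule LIMSEQ_offset)
qed

lemma powr_half_power2:
  fixes a p :: real
  assumes "a > 0"
  shows "(a\<^sup>2) powr (p / 2) = a powr p"
proof -
  have "a\<^sup>2 = a powr 2"
    using assms by simp
  then show ?thesis
    by (simp only: powr_powr) simp
qed

text \<open>The Poisson kernel of the half-space over \<open>'a\<close> at height \<open>a\<close>.
  The kernel of \<open>S2 t\<close> at \<open>x\<close> is this one at height
  \<open>x_N + t\<close>: time only raises the height.\<close>

definition poisson :: "real \<Rightarrow> 'a::euclidean_space \<Rightarrow> real" where
  "poisson a z = Gamma ((DIM('a) + 1) / 2) / pi powr ((DIM('a) + 1) / 2) *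
     (a * (a\<^sup>2 + (norm z)\<^sup>2) powr (- (DIM('a) + 1) / 2))"

lemma poisson_measurable [measurable]: "poisson a \<in> borel_measurable borel"
  unfolding poisson_def by measurable

lemma poisson_pos: "a > 0 \<Longrightarrow> poisson a z > 0"
  unfolding poisson_def by (auto intro!: mult_pos_pos divide_pos_pos Gamma_real_pos simp: add_pos_nonneg)

lemma poisson_scale:
  assumes "a > 0"
  shows "poisson a (a *\<^sub>R (z::'a::euclidean_space)) = poisson 1 z / a ^ DIM('a)"
proof -
  have "a\<^sup>2 + (norm (a *\<^sub>R z))\<^sup>2 = a\<^sup>2 * (1 + (norm z)\<^sup>2)"
    by (simp add: power_mult_distrib algebra_simps)
  moreover have "a * (a\<^sup>2) powr (- (DIM('a) + 1) / 2) = 1 / a ^ DIM('a)"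
  proof -
    have "a * (a\<^sup>2) powr (- (DIM('a) + 1) / 2) = a powr 1 * a powr (- (DIM('a) + 1))"
      using assms by (simp only: powr_half_power2) simp
    also have "\<dots> = a powr (- real DIM('a))"
      by (simp only: powr_add[symmetric]) simp
    finally show ?thesis
      using assms by (simp add: powr_minus_divide powr_realpow)
  qed
  moreover have "a * (P * W) = 1 * W / a ^ DIM('a)" if "a * P = 1 / a ^ DIM('a)" for P W
    using that by (metis mult.assoc mult_1 times_divide_eq_left)
  ultimately show ?thesis
    unfolding poisson_def by (simp only: powr_mult) (simp add: field_simps)
qed

lemma S2_eq_poisson:
  fixes x :: "(real^'n) \<times> real"
  assumes "snd x + t > 0"
  shows "S2 t \<psi> x = (LINT y|lebesgue. poisson (snd x + t) (fst x - y) * \<psi> y)"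
proof -
  let ?N = "real CARD('n) + 1" and ?a = "snd x + t"
  have "?a powr (1 - ?N) * (1 + q / ?a\<^sup>2) powr (- ?N / 2) = ?a * (?a\<^sup>2 + q) powr (- ?N / 2)"
    if "q \<ge> 0" for q
  proof -
    have "?a\<^sup>2 + q = ?a\<^sup>2 * (1 + q / ?a\<^sup>2)"
      using assms by (simp add: field_simps)
    then have "(?a\<^sup>2 + q) powr (- ?N / 2) = (?a\<^sup>2 * (1 + q / ?a\<^sup>2)) powr (- ?N / 2)"
      by (rule arg_cong)
    also have "\<dots> = ?a powr (- ?N) * (1 + q / ?a\<^sup>2) powr (- ?N / 2)"
      using that by (simp only: powr_mult powr_half_power2[OF assms])
    finally have "(?a\<^sup>2 + q) powr (- ?N / 2) = ?a powr (- ?N) * (1 + q / ?a\<^sup>2) powr (- ?N / 2)" .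
    moreover have "?a powr (1 - ?N) = ?a * ?a powr (- ?N)"
      using assms powr_add[of ?a 1 "- ?N"] by simp
    ultimately show ?thesis
      by simp
  qed
  then show ?thesis
    unfolding S2_def Let_def poisson_def by (simp flip: integral_mult_right_zero add: mult_ac add_ac)
qed

text \<open>By \<open>poisson_scale\<close> the kernel at height \<open>a\<close> is a dilation of
  the one at height 1 with the same mass, so \<open>A\<close> depends on neither \<open>a\<close>
  nor \<open>x\<close>.\<close>

lemma poisson_mass:
  obtains A where "A > 0"
    and "\<And>a x::'a::euclidean_space. a > 0 \<Longrightarrow> has_bochner_integral lborel (\<lambda>y. poisson a (x - y)) A"
proof
  define A where "A = (\<integral>z. poisson 1 (z::'a) \<partial>lborel)"
  have i: "integrable lborel (poisson 1 :: 'a \<Rightarrow> real)"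
  proof -
    have "integrable lborel (\<lambda>z::'a. (1\<^sup>2 + (norm z)\<^sup>2) powr (- (DIM('a) + 1) / 2))"
      using integrable_japanese_bracket[of "DIM('a) + 1", where ?'a = 'a] by simp
    then show ?thesis
      unfolding poisson_def by (intro integrable_mult_right)
  qed
  \<comment> \<open>A positive function with integral 0 would vanish almost everywhere, although
    \<open>lborel\<close> is not the zero measure.\<close>
  have "A \<noteq> 0"
  proof
    assume "A = 0"
    then have "AE z::'a in lborel. poisson 1 z = 0"
      using i unfolding A_def
      by (subst (asm) integral_nonneg_eq_0_iff_AE) (auto intro!: AE_I2 less_imp_le poisson_pos)
    then have "AE z::'a in lborel. False"
      by eventually_elim (use poisson_pos[of 1] in \<open>metis less_irrefl zero_less_one\<close>)
    then show False
      by (auto simp: eventually_False trivial_limit_def[symmetric] ae_filter_eq_bot_iff)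
  qed
  moreover have "A \<ge> 0"
    unfolding A_def by (intro Bochner_Integration.integral_nonneg) (use poisson_pos[OF zero_less_one] in \<open>auto intro: less_imp_le\<close>)
  ultimately show "A > 0"
    by simp
  show "has_bochner_integral lborel (\<lambda>y. poisson a (x - y)) A" if a: "a > 0" for a and x :: 'a
  proof -
    have "poisson a (x - (x + (- a) *\<^sub>R z)) = poisson 1 z / a ^ DIM('a)" for z :: 'a
      using poisson_scale[OF a, of z] by simp
    then have *: "(\<lambda>z. poisson a (x - (x + (- a) *\<^sub>R z))) = (\<lambda>z::'a. poisson 1 z / a ^ DIM('a))"
      by auto
    have j: "integrable lborel (\<lambda>y. poisson a (x - y))"
      using lborel_integrable_affine_iff[of "- a" "\<lambda>y. poisson a (x - y)" x] a i
      unfolding * by simp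
    from lborel_integral_affine[OF _ j, of "- a" x] a have "(\<integral>y. poisson a (x - y) \<partial>lborel) = A"
      unfolding * by (simp add: A_def)
    with j show ?thesis
      by (simp add: has_bochner_integral_iff)
  qed
qed

text \<open>The derivative is factored through \<open>poisson a z / a\<close>, so that it can be
  dominated by the kernel itself.\<close>

lemma poisson_has_derivative:
  fixes a :: real and z :: "'a::euclidean_space"
  assumes a: "a > 0"
  shows "((\<lambda>a. poisson a z) has_real_derivative
    poisson a z / a * (1 - (DIM('a) + 1) * a\<^sup>2 / (a\<^sup>2 + (norm z)\<^sup>2))) (at a)"
proof -
  define p where "p = - (real DIM('a) + 1) / 2"
  define c where "c = Gamma ((real DIM('a) + 1) / 2) / pi powr ((real DIM('a) + 1) / 2)"
  let ?r = "a\<^sup>2 + (norm z)\<^sup>2"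
  have r: "?r > 0"
    using a by (simp add: add_pos_nonneg)
  then have "?r powr (p - 1) = ?r powr p / ?r"
    by (simp add: powr_diff)
  then have "((\<lambda>a. a * (a\<^sup>2 + (norm z)\<^sup>2) powr p) has_real_derivative
      ?r powr p * (1 + 2 * p * a\<^sup>2 / ?r)) (at a)"
    using r by (auto intro!: derivative_eq_intros simp: field_simps power2_eq_square)
  then have "((\<lambda>a. c * (a * (a\<^sup>2 + (norm z)\<^sup>2) powr p)) has_real_derivative
      c * (?r powr p * (1 + 2 * p * a\<^sup>2 / ?r))) (at a)"
    by (rule DERIV_cmult)
  moreover have "poisson a z / a = c * ?r powr p"
    using a by (auto simp: poisson_def c_def p_def add.commute)
  moreover have "1 + 2 * p * a\<^sup>2 / ?r = 1 - (DIM('a) + 1) * a\<^sup>2 / ?r"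
  proof -
    have "2 * p = - (real DIM('a) + 1)"
      by (simp add: p_def)
    then show ?thesis
      by (simp only: mult_minus_left minus_divide_left[symmetric]) simp
  qed
  moreover have "(\<lambda>a. c * (a * (a\<^sup>2 + (norm z)\<^sup>2) powr p)) = (\<lambda>a. poisson a z)"
    by (auto simp: poisson_def c_def p_def add.commute)
  ultimately show ?thesis
    by (simp add: mult.assoc)
qed

text \<open>With \<open>d\<close> the dimension, the bracket is \<open>1 - (d + 1) \<theta>\<close>
  for some \<theta> between 0 and 1, hence lies between \<open>- d\<close> and 1.\<close>

lemma poisson_derivative_bound:
  fixes a :: real and z :: "'a::euclidean_space"
  assumes a: "a > 0"
  shows "\<bar>poisson a z / a * (1 - (DIM('a) + 1) * a\<^sup>2 / (a\<^sup>2 + (norm z)\<^sup>2))\<bar>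
           \<le> (DIM('a) + 1) * (poisson a z / a)"
proof -
  let ?\<theta> = "a\<^sup>2 / (a\<^sup>2 + (norm z)\<^sup>2)"
  have \<theta>: "0 \<le> ?\<theta>" "?\<theta> \<le> 1"
    using a by (auto simp: divide_simps add_pos_nonneg)
  have "0 \<le> (real DIM('a) + 1) * ?\<theta>" "(real DIM('a) + 1) * ?\<theta> \<le> real DIM('a) + 1"
    using mult_left_mono[OF \<theta>(2), of "real DIM('a) + 1"] \<theta>(1) by simp_all
  then have "\<bar>1 - (real DIM('a) + 1) * ?\<theta>\<bar> \<le> real DIM('a) + 1"
    unfolding abs_le_iff by linarith
  then show ?thesis
    using mult_left_mono[of "\<bar>1 - (real DIM('a) + 1) * ?\<theta>\<bar>" "real DIM('a) + 1" "poisson a z / a"]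
      poisson_pos[OF a, of z] a
    by (simp add: abs_mult mult_ac add_ac)
qed

text \<open>After division by \<open>a\<close> only a negative power of \<open>a^2 + |z|^2\<close>
  is left. The left end of an interval of heights thus dominates the derivative on the whole
  interval.\<close>

lemma poisson_over_antimono:
  fixes z :: "'a::euclidean_space"
  assumes "0 < b" "b \<le> a"
  shows "poisson a z / a \<le> poisson b z / b"
proof -
  have "(a\<^sup>2 + (norm z)\<^sup>2) powr (- (DIM('a) + 1) / 2) \<le> (b\<^sup>2 + (norm z)\<^sup>2) powr (- (DIM('a) + 1) / 2)"
    using assms by (intro powr_mono2') (auto simp: add_pos_nonneg power_mono)
  then show ?thesis
    using assms unfolding poisson_def
    by (auto intro!: divide_right_mono mult_left_mono less_imp_le[OF Gamma_real_pos])
qed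

section \<open>Bounds for \<open>S2\<close> and its time derivative\<close>

lemma lebesgue_integral_borel:
  fixes f :: "'a::euclidean_space \<Rightarrow> real"
  assumes "integrable lborel f"
  shows "integrable lebesgue f" "integral\<^sup>L lebesgue f = integral\<^sup>L lborel f"
  using assms integrable_completion[of f lborel] integral_completion[of f lborel] by auto

lemma abs_S2_le:
  fixes x :: "(real^'n) \<times> real"
  assumes A: "\<And>a x::real^'n. a > 0 \<Longrightarrow> has_bochner_integral lborel (\<lambda>y. poisson a (x - y)) A"
    and "snd x + t > 0" "\<And>y. \<bar>\<psi> y\<bar> \<le> B"
  shows "\<bar>S2 t \<psi> x\<bar> \<le> A * B"
proof -
  let ?p = "\<lambda>y. poisson (snd x + t) (fst x - y)"
  have i: "integrable lborel (\<lambda>y. ?p y * B)"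
    using A[OF assms(2), of "fst x"] by (auto simp: has_bochner_integral_iff)
  have "\<bar>S2 t \<psi> x\<bar> \<le> integral\<^sup>L lebesgue (\<lambda>y. ?p y * B)"
    unfolding S2_eq_poisson[OF assms(2)]
  proof (rule abs_integral_le_integral)
    show "\<bar>?p y * \<psi> y\<bar> \<le> ?p y * B" for y
      using assms(3)[of y] poisson_pos[OF assms(2), of "fst x - y"]
      by (auto simp: abs_mult intro!: mult_left_mono)
  qed (rule lebesgue_integral_borel(1)[OF i])
  also have "\<dots> = A * B"
    using A[OF assms(2), of "fst x"] lebesgue_integral_borel(2)[OF i]
    by (auto simp: has_bochner_integral_iff)
  finally show ?thesis .
qed

lemma poisson_integrable:
  fixes z :: "'a::euclidean_space"
  assumes A: "\<And>a x::'a. a > 0 \<Longrightarrow> has_bochner_integral lborel (\<lambda>y. poisson a (x - y)) A"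
    and a: "a > 0" and \<psi>: "\<psi> \<in> borel_measurable borel" "\<And>y. \<bar>\<psi> y\<bar> \<le> B"
  shows "integrable lborel (\<lambda>y. poisson a (z - y) * \<psi> y)"
proof (rule Bochner_Integration.integrable_bound)
  show "integrable lborel (\<lambda>y. poisson a (z - y) * B)"
    using A[OF a, of z] by (auto simp: has_bochner_integral_iff)
  have "0 \<le> B"
    using \<psi>(2)[of 0] by simp
  then show "AE y in lborel. norm (poisson a (z - y) * \<psi> y) \<le> norm (poisson a (z - y) * B)"
    using \<psi>(2) by (intro AE_I2) (auto simp: abs_mult intro!: mult_left_mono)
qed (use \<psi>(1) in measurable)

text \<open>Meant for negative \<open>b\<close>, to carry the sign of the flux over to
  \<open>w\<close>. Integrability has to be established here, because the default value 0 would
  violate a negative upper bound.\<close>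

lemma S2_le:
  fixes x :: "(real^'n) \<times> real"
  assumes A: "\<And>a x::real^'n. a > 0 \<Longrightarrow> has_bochner_integral lborel (\<lambda>y. poisson a (x - y)) A"
    and a: "snd x + t > 0" and \<psi>: "\<psi> \<in> borel_measurable borel" "\<And>y. \<bar>\<psi> y\<bar> \<le> B" "\<And>y. \<psi> y \<le> b"
  shows "S2 t \<psi> x \<le> A * b"
proof -
  let ?p = "\<lambda>y. poisson (snd x + t) (fst x - y)"
  note i = poisson_integrable[OF A a \<psi>(1,2), of "fst x"]
  have "S2 t \<psi> x = (\<integral>y. ?p y * \<psi> y \<partial>lborel)"
    unfolding S2_eq_poisson[OF a] using lebesgue_integral_borel(2)[OF i] by simp
  also have "\<dots> \<le> (\<integral>y. ?p y * b \<partial>lborel)"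
    using A[OF a, of "fst x"] i less_imp_le[OF poisson_pos[OF a]] \<psi>(3)
    by (intro integral_mono mult_left_mono) (auto simp: has_bochner_integral_iff)
  also have "\<dots> = A * b"
    using A[OF a, of "fst x"] by (auto simp: has_bochner_integral_iff)
  finally show ?thesis .
qed

text \<open>Time enters only through the height, so the time derivative falls on the kernel and
  costs one power of the height.\<close>

lemma abs_deriv_S2_le:
  fixes x :: "(real^'n) \<times> real" and A B :: real
  assumes A: "\<And>a x::real^'n. a > 0 \<Longrightarrow> has_bochner_integral lborel (\<lambda>y. poisson a (x - y)) A"
    and a: "snd x + (t - s) > 0" and \<psi>: "\<psi> \<in> borel_measurable borel" "\<And>y. \<bar>\<psi> y\<bar> \<le> B"
  shows "\<bar>deriv (\<lambda>r. S2 (r - s) \<psi> x) t\<bar> \<le> (CARD('n) + 1) * A * B / (snd x + (t - s))"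
proof -
  define a0 where "a0 = snd x + (t - s)"
  define z where "z = fst x"
  define k' where "k' = (\<lambda>(a::real) (z::real^'n). poisson a z / a * (1 - (CARD('n) + 1) * a\<^sup>2 / (a\<^sup>2 + (norm z)\<^sup>2)))"
  let ?J = "\<lambda>a. \<integral>y. poisson a (z - y) * \<psi> y \<partial>lborel"
  let ?D = "\<integral>y. k' a0 (z - y) * \<psi> y \<partial>lborel"
  \<comment> \<open>The majorant for all heights in the ball of radius \<open>a0 / 2\<close> about
    \<open>a0\<close>, taken at the lower end \<open>a0 / 2\<close>.\<close>
  let ?h = "\<lambda>y. (CARD('n) + 1) * (poisson (a0/2) (z - y) / (a0/2)) * B"
  have a0: "a0 > 0"
    using a by (simp add: a0_def)
  have B: "B \<ge> 0"
    using \<psi>(2)[of 0] by simp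
  have k'_bound: "\<bar>k' b (z - y) * \<psi> y\<bar> \<le> (CARD('n) + 1) * (poisson b (z - y) / b) * B" if "b > 0" for b y
    unfolding abs_mult[of _ "\<psi> y"]
    using poisson_derivative_bound[OF that, of "z - y"] \<psi>(2)[of y] that poisson_pos[OF that, of "z - y"]
    by (intro mult_mono) (auto simp: k'_def)
  have "(?J has_real_derivative ?D) (at a0)"
  proof (rule has_real_derivative_integral[where e = "a0/2" and h = ?h])
    show "a0 / 2 > 0" using a0 by simp
    have pos: "a0 / 2 < a" if "a \<in> ball a0 (a0 / 2)" for a
    proof -
      have "\<bar>a0 - a\<bar> < a0 / 2"
        using that by (simp add: dist_real_def)
      then show ?thesis
        by linarith
    qed
    fix a assume a: "a \<in> ball a0 (a0 / 2)"
    then have a_pos: "a > 0"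
      using pos[OF a] a0 by simp
    show "integrable lborel (\<lambda>y. poisson a (z - y) * \<psi> y)"
      by (rule poisson_integrable[OF A a_pos \<psi>])
    fix y
    show "((\<lambda>a. poisson a (z - y) * \<psi> y) has_real_derivative k' a (z - y) * \<psi> y) (at a)"
      using DERIV_cmult_right[OF poisson_has_derivative[OF a_pos, of "z - y"], of "\<psi> y"]
      by (simp add: k'_def mult_ac)
    have "(CARD('n) + 1) * (poisson a (z - y) / a) * B \<le> ?h y"
      using poisson_over_antimono[of "a0/2" a "z - y"] pos[OF a] a0 B
      by (intro mult_right_mono mult_left_mono) auto
    then show "\<bar>k' a (z - y) * \<psi> y\<bar> \<le> ?h y"
      using k'_bound[OF a_pos, of y] by linarith
  next
    show "(\<lambda>y. k' a0 (z - y) * \<psi> y) \<in> borel_measurable lborel"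
      using \<psi>(1) unfolding k'_def by measurable
    show "integrable lborel ?h"
      using A[of "a0/2" z] a0 by (auto simp: has_bochner_integral_iff)
  qed
  moreover have "((\<lambda>r. snd x + (r - s)) has_real_derivative 1) (at t)"
    by (auto intro!: derivative_eq_intros)
  ultimately have "((\<lambda>r. ?J (snd x + (r - s))) has_real_derivative ?D) (at t)"
    using DERIV_chain'[of "\<lambda>r. snd x + (r - s)" 1 t UNIV ?J ?D]
    by (simp add: a0_def)
  \<comment> \<open>The formula for \<open>S2\<close> as a Poisson integral holds at positive
    heights only; these \<open>r\<close> form an open neighbourhood of \<open>t\<close>, which is
    enough for the derivative.\<close>
  moreover have "S2 (r - s) \<psi> x = ?J (snd x + (r - s))" if "r \<in> {s - snd x<..}" for r
  proof -
    have r: "snd x + (r - s) > 0"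
      using that by auto
    show ?thesis
      unfolding S2_eq_poisson[OF r] z_def
      by (rule lebesgue_integral_borel(2)[OF poisson_integrable[OF A r \<psi>]])
  qed
  ultimately have "((\<lambda>r. S2 (r - s) \<psi> x) has_real_derivative ?D) (at t)"
    using a by (auto intro!: has_field_derivative_transform_within_open[of "\<lambda>r. ?J (snd x + (r - s))" ?D t "{s - snd x<..}"])
  then have "deriv (\<lambda>r. S2 (r - s) \<psi> x) t = ?D"
    by (rule DERIV_imp_deriv)
  also have "\<bar>?D\<bar> \<le> (\<integral>y. (CARD('n) + 1) * (poisson a0 (z - y) / a0) * B \<partial>lborel)"
    using A[OF a0, of z] k'_bound[OF a0]
    by (intro abs_integral_le_integral) (auto simp: has_bochner_integral_iff)
  also have "\<dots> = (CARD('n) + 1) * A * B / a0"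
    using A[OF a0, of z] by (auto simp: has_bochner_integral_iff)
  finally show ?thesis
    by (simp add: a0_def)
qed

section \<open>The Dirichlet heat kernel\<close>

text \<open>From \<open>(1 + x/m)^m \<le> exp x\<close> with \<open>m\<close> the dimension and
  \<open>x = q / 4\<close>, the Gaussian is dominated by a multiple of \<open>(1 + q)^(-m)\<close>.
  For \<open>q = |z|^2\<close> this is the bracket with exponent \<open>p = 2 m > m\<close>.\<close>

lemma integrable_gaussian: "integrable lborel (\<lambda>z::'a::euclidean_space. exp (- (norm z)\<^sup>2 / 4))"
proof (rule Bochner_Integration.integrable_bound)
  let ?m = "DIM('a)"
  have m: "real ?m \<ge> 1"
    using DIM_positive[where ?'a = 'a] by linarith
  show "integrable lborel (\<lambda>z::'a. (4 * ?m) ^ ?m * (1 + (norm z)\<^sup>2) powr (- (2 * real ?m) / 2))"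
    by (intro integrable_mult_right integrable_japanese_bracket) simp
  have "exp (- q / 4) \<le> (4 * ?m) ^ ?m * (1 + q) powr (- (2 * real ?m) / 2)" if "q \<ge> 0" for q :: real
  proof -
    have "(1 + q) / (4 * M) \<le> 1 + (q / 4) / M" if "M \<ge> 1" for M :: real
      using that \<open>q \<ge> 0\<close> by (simp add: field_simps)
    then have "((1 + q) / (4 * ?m)) ^ ?m \<le> (1 + (q / 4) / ?m) ^ ?m"
      using that m by (intro power_mono) auto
    also have "\<dots> \<le> exp (q / 4)"
      using that m by (intro exp_ge_one_plus_x_over_n_power_n) (auto intro: order_trans[of _ 0])
    finally have "1 / exp (q / 4) \<le> 1 / ((1 + q) / (4 * ?m)) ^ ?m"
      using that m by (intro divide_left_mono) auto
    moreover have "exp (- q / 4) = 1 / exp (q / 4)"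
      by (simp add: exp_minus inverse_eq_divide)
    moreover have "(1 + q) powr (- (2 * real ?m) / 2) = 1 / (1 + q) ^ ?m"
      using that by (simp add: powr_minus_divide powr_realpow)
    ultimately show ?thesis
      by (simp add: power_divide)
  qed
  then show "AE z::'a in lborel. norm (exp (- (norm z)\<^sup>2 / 4))
      \<le> norm ((4 * ?m) ^ ?m * (1 + (norm z)\<^sup>2) powr (- (2 * real ?m) / 2))"
    by (intro AE_I2) (auto intro: order_trans[OF _ abs_ge_self])
qed simp

lemma gaussian_mass:
  obtains G where "G > 0"
    and "\<And>t x::'a::euclidean_space. t > 0 \<Longrightarrow>
      has_bochner_integral lborel (\<lambda>y. exp (- (norm (x - y))\<^sup>2 / (4 * t))) (G * t powr (DIM('a) / 2))"
proof
  define G where "G = (\<integral>z. exp (- (norm (z::'a))\<^sup>2 / 4) \<partial>lborel)"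
  have "G \<noteq> 0"
  proof
    assume "G = 0"
    then have "AE z::'a in lborel. exp (- (norm z)\<^sup>2 / 4) = 0"
      unfolding G_def by (subst (asm) integral_nonneg_eq_0_iff_AE[OF integrable_gaussian]) auto
    then show False
      by (auto simp: eventually_False trivial_limit_def[symmetric] ae_filter_eq_bot_iff)
  qed
  moreover have "G \<ge> 0"
    unfolding G_def by (intro Bochner_Integration.integral_nonneg) auto
  ultimately show "G > 0"
    by simp
  show "has_bochner_integral lborel (\<lambda>y. exp (- (norm (x - y))\<^sup>2 / (4 * t))) (G * t powr (DIM('a) / 2))"
    if t: "t > 0" for t and x :: 'a
  proof -
    let ?f = "\<lambda>y. exp (- (norm (x - y))\<^sup>2 / (4 * t))"
    have *: "(\<lambda>z. ?f (x + (- sqrt t) *\<^sub>R z)) = (\<lambda>z::'a. exp (- (norm z)\<^sup>2 / 4))"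
      using t by (auto simp: power_mult_distrib)
    have j: "integrable lborel ?f"
      using lborel_integrable_affine_iff[of "- sqrt t" ?f x] t integrable_gaussian[where ?'a = 'a]
      unfolding * by simp
    have "(sqrt t) ^ DIM('a) = t powr (DIM('a) / 2)"
      using t by (simp add: powr_half_sqrt[symmetric] powr_power)
    with lborel_integral_affine[OF _ j, of "- sqrt t" x] t
    have "(\<integral>y. ?f y \<partial>lborel) = G * t powr (DIM('a) / 2)"
      unfolding * by (simp add: G_def)
    with j show ?thesis
      by (simp add: has_bochner_integral_iff)
  qed
qed

text \<open>The Dirichlet heat kernel of the half-line by the method of images, without its
  normalising factor.\<close>

definition dkernel :: "real \<Rightarrow> real \<Rightarrow> real \<Rightarrow> real" where
  "dkernel t x y = exp (- (x - y)\<^sup>2 / (4 * t)) - exp (- (x + y)\<^sup>2 / (4 * t))"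

lemma dkernel_measurable [measurable]: "dkernel t x \<in> borel_measurable borel"
  unfolding dkernel_def by measurable

text \<open>In factored form the sign is visible, and \<open>1 - exp (- s) \<le> s\<close> shows
  that the kernel vanishes linearly in both \<open>x\<close> and \<open>y\<close>.\<close>

lemma dkernel_eq:
  assumes "t > 0"
  shows "dkernel t x y = exp (- (x - y)\<^sup>2 / (4 * t)) * (1 - exp (- (x * y / t)))"
proof -
  have "- (x + y)\<^sup>2 / (4 * t) = - (x - y)\<^sup>2 / (4 * t) + - (x * y / t)"
    using assms by (simp add: field_simps power2_eq_square)
  then show ?thesis
    unfolding dkernel_def by (simp only: exp_add) (simp add: algebra_simps)
qed

lemma dkernel_nonneg: "t > 0 \<Longrightarrow> x \<ge> 0 \<Longrightarrow> y \<ge> 0 \<Longrightarrow> 0 \<le> dkernel t x y"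
  by (simp add: dkernel_eq)

lemma dkernel_le:
  assumes "t > 0" "x \<ge> 0" "y \<ge> 0"
  shows "dkernel t x y \<le> x * y / t"
proof -
  have "dkernel t x y \<le> 1 * (x * y / t)"
    unfolding dkernel_eq[OF assms(1)] using assms exp_ge_add_one_self[of "- (x * y / t)"]
    by (intro mult_mono) auto
  then show ?thesis by simp
qed

text \<open>Centring both Gaussians at the origin turns the two terms into integrals over
  \<open>(-x, \<infinity>)\<close> and \<open>(x, \<infinity>)\<close>; the common tail
  cancels.\<close>

lemma dkernel_integral:
  assumes t: "t > 0" and x: "x \<ge> 0"
  shows integrable_dkernel: "integrable lborel (\<lambda>y. indicator {0<..} y * dkernel t x y)"
    and dkernel_integral_eq: "(\<integral>y. indicator {0<..} y * dkernel t x y \<partial>lborel)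
      = (\<integral>u. indicator {-x<..x} u * exp (- u\<^sup>2 / (4 * t)) \<partial>lborel)"
proof -
  let ?E = "\<lambda>u::real. exp (- u\<^sup>2 / (4 * t))"
  obtain G where "has_bochner_integral lborel (\<lambda>y::real. exp (- (norm (0 - y))\<^sup>2 / (4 * t))) G"
    using gaussian_mass[where ?'a = real] t by metis
  then have E: "integrable lborel ?E"
    by (auto simp: has_bochner_integral_iff)
  have iE: "integrable lborel (\<lambda>u. indicator S u * ?E u)" if "S \<in> sets borel" for S
    using integrable_mult_indicator[of S lborel ?E] that E by simp
  have shift: "integrable lborel (\<lambda>y. indicator {0<..} y * ?E (y - a))"
      "(\<integral>y. indicator {0<..} y * ?E (y - a) \<partial>lborel) = (\<integral>u. indicator {-a<..} u * ?E u \<partial>lborel)" for a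
  proof -
    have *: "(\<lambda>u. indicator {0<..} (a + 1 * u) * ?E (a + 1 * u - a)) = (\<lambda>u. indicator {-a<..} u * ?E u)"
      by (auto simp: indicator_def)
    show "integrable lborel (\<lambda>y. indicator {0<..} y * ?E (y - a))"
      using lborel_integrable_real_affine_iff[of 1 "\<lambda>y. indicator {0<..} y * ?E (y - a)" a] iE[of "{-a<..}"]
      unfolding * by simp
    show "(\<integral>y. indicator {0<..} y * ?E (y - a) \<partial>lborel) = (\<integral>u. indicator {-a<..} u * ?E u \<partial>lborel)"
      using lborel_integral_real_affine[of 1 "\<lambda>y. indicator {0<..} y * ?E (y - a)" a]
      unfolding * by simp
  qed
  have eq: "indicator {0<..} y * dkernel t x y
      = indicator {0<..} y * ?E (y - x) - indicator {0<..} y * ?E (y - (- x))" for y :: real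
    by (simp add: dkernel_def right_diff_distrib power2_commute[of x y] add.commute)
  show "integrable lborel (\<lambda>y. indicator {0<..} y * dkernel t x y)"
    unfolding eq by (intro Bochner_Integration.integrable_diff shift)
  have "(\<integral>y. indicator {0<..} y * dkernel t x y \<partial>lborel)
      = (\<integral>u. indicator {-x<..} u * ?E u \<partial>lborel) - (\<integral>u. indicator {x<..} u * ?E u \<partial>lborel)"
    unfolding eq using shift[of x] shift[of "- x"] by (subst Bochner_Integration.integral_diff) auto
  also have "\<dots> = (\<integral>u. indicator {-x<..} u * ?E u - indicator {x<..} u * ?E u \<partial>lborel)"
    using iE[of "{-x<..}"] iE[of "{x<..}"] by simp
  also have "\<dots> = (\<integral>u. indicator {-x<..x} u * ?E u \<partial>lborel)"
    using x by (intro Bochner_Integration.integral_cong) (auto simp: indicator_def)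
  finally show "(\<integral>y. indicator {0<..} y * dkernel t x y \<partial>lborel)
      = (\<integral>u. indicator {-x<..x} u * exp (- u\<^sup>2 / (4 * t)) \<partial>lborel)" .
qed

lemma dkernel_integral_le:
  assumes t: "t > 0" and x: "x \<ge> 0"
  shows "(\<integral>y. indicator {0<..} y * dkernel t x y \<partial>lborel) \<le> 2 * x"
proof -
  have "(\<integral>u. indicator {-x<..x} u * exp (- u\<^sup>2 / (4 * t)) \<partial>lborel) \<le> (\<integral>u. indicator {-x<..x} u \<partial>lborel)"
    using t x by (intro integral_mono_AE' integrable_real_indicator) (auto simp: indicator_def)
  also have "\<dots> = 2 * x"
    using x by simp
  finally show ?thesis
    by (simp add: dkernel_integral_eq[OF assms])
qed

text \<open>On \<open>|u| \<le> x \<le> sqrt t\<close> the exponent is at least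
  \<open>- 1/4\<close>, and the interval has length \<open>2 x\<close>. This gives the exact order
  in \<open>x\<close> near the boundary.\<close>

lemma dkernel_integral_ge:
  assumes t: "t > 0" and x: "x \<ge> 0" "x\<^sup>2 \<le> t"
  shows "2 * x * exp (- 1 / 4) \<le> (\<integral>y. indicator {0<..} y * dkernel t x y \<partial>lborel)"
proof -
  have E: "exp (- 1 / 4) \<le> exp (- u\<^sup>2 / (4 * t))" if "u \<in> {-x<..x}" for u
  proof -
    have "u\<^sup>2 \<le> x\<^sup>2"
      using that by (intro abs_le_square_iff[THEN iffD1]) auto
    then show ?thesis
      using x t by (auto simp: divide_simps)
  qed
  have "2 * x * exp (- 1 / 4) = (\<integral>u. indicator {-x<..x} u * exp (- 1 / 4) \<partial>lborel)"
    using x by simp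
  also have "\<dots> \<le> (\<integral>u. indicator {-x<..x} u * exp (- u\<^sup>2 / (4 * t)) \<partial>lborel)"
  proof (rule integral_mono)
    show "integrable lborel (\<lambda>u. indicat_real {-x<..x} u * exp (- 1 / 4))"
      using x by (intro integrable_mult_left integrable_real_indicator) auto
    show "integrable lborel (\<lambda>u. indicat_real {-x<..x} u * exp (- u\<^sup>2 / (4 * t)))"
      using t x by (intro Bochner_Integration.integrable_bound[OF integrable_real_indicator[of "{-x<..x}" lborel]])
        (auto simp: indicator_def)
  qed (use E in \<open>auto simp: indicator_def\<close>)
  finally show ?thesis
    by (simp add: dkernel_integral_eq[OF t x(1)])
qed

section \<open>Reduction of \<open>S1\<close> to the half-line kernel\<close>

lemma halfspace_product_integral:
  fixes e :: "real^'n \<Rightarrow> real" and k :: "real \<Rightarrow> real"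
  assumes e: "has_bochner_integral lborel e I"
    and k: "integrable lborel (\<lambda>y. indicator {0<..} y * k y)"
  shows integrable_halfspace_product: "integrable (lebesgue_on halfspace) (\<lambda>y. e (fst y) * k (snd y))"
    and integral_halfspace_product: "(LINT y|lebesgue_on halfspace. e (fst y) * k (snd y))
      = I * (\<integral>y. indicator {0<..} y * k y \<partial>lborel)"
proof -
  have hs: "(halfspace :: ((real^'n) \<times> real) set) \<in> sets borel"
    unfolding halfspace_def by (intro borel_open open_Times) auto
  have eq: "indicator halfspace y *\<^sub>R (e (fst y) * k (snd y)) = e (fst y) * (indicator {0<..} (snd y) * k (snd y))"
    for y :: "(real^'n) \<times> real"
    by (auto simp: halfspace_def indicator_def mem_Times_iff)
  note e' = e[unfolded has_bochner_integral_iff]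
  have i: "set_integrable lborel halfspace (\<lambda>y. e (fst y) * k (snd y))"
    unfolding set_integrable_def eq by (intro lborel_integrable_product k conjunct1[OF e'])
  show "integrable (lebesgue_on halfspace) (\<lambda>y. e (fst y) * k (snd y))"
    by (rule integrable_lebesgue_on_borel[OF hs i])
  show "(LINT y|lebesgue_on halfspace. e (fst y) * k (snd y))
      = I * (\<integral>y. indicator {0<..} y * k y \<partial>lborel)"
    unfolding integral_lebesgue_on_borel[OF hs i] set_lebesgue_integral_def eq
    using lborel_integral_product[OF conjunct1[OF e'] k] e' by simp
qed

text \<open>Reflection changes only the last coordinate, so the tangential Gaussian is a common
  factor.\<close>

lemma S1_kernel_eq:
  fixes x y :: "(real^'n) \<times> real"
  shows "exp (- (norm (x - y))\<^sup>2 / (4 * t)) - exp (- (norm (x - reflect y))\<^sup>2 / (4 * t))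
    = exp (- (norm (fst x - fst y))\<^sup>2 / (4 * t)) * dkernel t (snd x) (snd y)"
proof -
  have n: "(norm z)\<^sup>2 = (norm (fst z))\<^sup>2 + (snd z)\<^sup>2" for z :: "(real^'n) \<times> real"
    by (simp add: norm_prod_def)
  show ?thesis
    unfolding n dkernel_def reflect_def right_diff_distrib exp_add[symmetric]
    by (simp add: diff_divide_distrib)
qed

text \<open>Every estimate except nonnegativity is linear in \<open>x_N\<close>, because it will be
  divided by \<open>x_N\<close> to reach the normal derivative. The weight
  \<open>p + q y_N^(-1/2)\<close> is the shape of the bound for \<open>F2\<close> in
  \<open>abs_F2_le\<close>.\<close>

locale dirichlet_bounds =
  fixes dim :: "'n::finite itself" and b :: real
  assumes b_pos: "b > 0"
    and S1_one_le: "\<And>t (x::(real^'n) \<times> real). t > 0 \<Longrightarrow> snd x > 0 \<Longrightarrow>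
      S1 t (\<lambda>_. 1) x \<le> 2 * b * snd x * t powr (- 1 / 2)"
    and S1_one_nonneg: "\<And>t (x::(real^'n) \<times> real). t > 0 \<Longrightarrow> snd x > 0 \<Longrightarrow> 0 \<le> S1 t (\<lambda>_. 1) x"
    and S1_one_ge: "\<And>t (x::(real^'n) \<times> real). t > 0 \<Longrightarrow> snd x > 0 \<Longrightarrow> (snd x)\<^sup>2 \<le> t \<Longrightarrow>
      2 * b * exp (- 1 / 4) * snd x * t powr (- 1 / 2) \<le> S1 t (\<lambda>_. 1) x"
    and abs_S1_le: "\<And>t (x::(real^'n) \<times> real) p q \<phi>. t > 0 \<Longrightarrow> snd x > 0 \<Longrightarrow> p \<ge> 0 \<Longrightarrow> q \<ge> 0 \<Longrightarrow>
      (\<And>y. y \<in> halfspace \<Longrightarrow> \<bar>\<phi> y\<bar> \<le> p + q * snd y powr (- 1 / 2)) \<Longrightarrow>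
      \<bar>S1 t \<phi> x\<bar> \<le> b * snd x * t powr (- 1 / 2) * (2 * p + 3 * q * t powr (- 1 / 4))"

lemma S1_bounds: obtains b where "dirichlet_bounds TYPE('n::finite) b"
proof -
  obtain G where G: "G > 0" "\<And>t x::real^'n. t > 0 \<Longrightarrow>
      has_bochner_integral lborel (\<lambda>y. exp (- (norm (x - y))\<^sup>2 / (4 * t))) (G * t powr (CARD('n) / 2))"
    using gaussian_mass[where ?'a = "real^'n"] by auto
  \<comment> \<open>With \<open>n = CARD('n)\<close>, the tangential mass \<open>G t^(n/2)\<close>
    against \<open>(4 pi t)^(-(n+1)/2)\<close> leaves \<open>b t^(-1/2)\<close>.\<close>
  define b where "b = (4 * pi) powr (- (real CARD('n) + 1) / 2) * G"
  have b: "b > 0"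
    using G(1) by (simp add: b_def)
  have const: "(4 * pi * t) powr (- real DIM((real^'n) \<times> real) / 2) * (G * t powr (CARD('n) / 2) * I)
      = b * t powr (- 1 / 2) * I" if "t > 0" for t I
  proof -
    have "t powr (- (real CARD('n) + 1) / 2) * t powr (CARD('n) / 2) = t powr (- 1 / 2)"
      by (simp only: powr_add[symmetric]) (simp add: field_simps)
    moreover have "(4 * pi * t) powr (- (real CARD('n) + 1) / 2)
        = (4 * pi) powr (- (real CARD('n) + 1) / 2) * t powr (- (real CARD('n) + 1) / 2)"
      using that by (intro powr_mult)
    moreover have "real DIM((real^'n) \<times> real) = real CARD('n) + 1"
      by simp
    moreover have "K * T * (G * S * I) = K * G * (T * S) * I" for K T S
      by (simp add: mult_ac)
    ultimately show ?thesis
      by (simp only: b_def)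
  qed
  let ?I = "\<lambda>t x. \<integral>y. indicator {0<..} y * dkernel t x y \<partial>lborel"
  have S1_1: "S1 t (\<lambda>_. 1) x = b * t powr (- 1 / 2) * ?I t (snd x)"
    if "t > 0" "snd x > 0" for t and x :: "(real^'n) \<times> real"
    unfolding S1_def S1_kernel_eq mult_1_right
    using integral_halfspace_product[OF G(2)[OF that(1)] integrable_dkernel[OF that(1) less_imp_le[OF that(2)]], of "fst x"]
      const[OF that(1)] by simp
  have "dirichlet_bounds TYPE('n) b"
  proof (rule dirichlet_bounds.intro[OF b])
    fix t :: real and x :: "(real^'n) \<times> real" assume t: "t > 0" and x: "snd x > 0"
    have c: "b * t powr (- 1 / 2) \<ge> 0"
      using b by simp
    show "S1 t (\<lambda>_. 1) x \<le> 2 * b * snd x * t powr (- 1 / 2)"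
      using mult_left_mono[OF dkernel_integral_le[OF t less_imp_le[OF x]] c] S1_1[OF t x] by (simp add: mult_ac)
    have "?I t (snd x) \<ge> 0"
      using t x by (intro Bochner_Integration.integral_nonneg) (auto simp: indicator_def dkernel_nonneg)
    then show "0 \<le> S1 t (\<lambda>_. 1) x"
      using S1_1[OF t x] c by simp
    show "2 * b * exp (- 1 / 4) * snd x * t powr (- 1 / 2) \<le> S1 t (\<lambda>_. 1) x" if "(snd x)\<^sup>2 \<le> t"
      using mult_left_mono[OF dkernel_integral_ge[OF t less_imp_le[OF x] that] c] S1_1[OF t x] by (simp add: mult_ac)
    fix p q :: real and \<phi> :: "(real^'n) \<times> real \<Rightarrow> real"
    assume p: "p \<ge> 0" and q: "q \<ge> 0"
      and \<phi>: "\<And>y. y \<in> halfspace \<Longrightarrow> \<bar>\<phi> y\<bar> \<le> p + q * snd y powr (- 1 / 2)"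
    \<comment> \<open>The weight \<open>r\<^sup>-\<^sup>1\<^sup>/\<^sup>2\<close> is bounded by its value at \<open>r = t\<^sup>1\<^sup>/\<^sup>2\<close> beyond that point; below it,
      the kernel is at most \<open>x\<^sub>N r / t\<close>.\<close>
    define P where "P = p + q * t powr (- 1 / 4)"
    define Q where "Q = q * snd x * t powr (- 3 / 4)"
    define k where "k = (\<lambda>y. P * dkernel t (snd x) y + Q * indicator {0<..<sqrt t} y)"
    have PQ: "P \<ge> 0" "Q \<ge> 0"
      using p q x by (auto simp: P_def Q_def)
    have k_eq: "indicator {0<..} y * k y = P * (indicator {0<..} y * dkernel t (snd x) y) + Q * indicator {0<..<sqrt t} y" for y
      by (auto simp: k_def indicator_def)
    note id = integrable_dkernel[OF t less_imp_le[OF x]]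
    have ii: "integrable lborel (indicat_real {0<..<sqrt t})"
      using t by (intro integrable_real_indicator) auto
    have ik: "integrable lborel (\<lambda>y. indicator {0<..} y * k y)"
      unfolding k_eq by (intro Bochner_Integration.integrable_add integrable_mult_right id ii)
    have "(\<integral>y. indicator {0<..} y * k y \<partial>lborel) = P * ?I t (snd x) + Q * sqrt t"
      unfolding k_eq using id ii t by simp
    also have "\<dots> \<le> P * (2 * snd x) + Q * sqrt t"
      using PQ dkernel_integral_le[OF t less_imp_le[OF x]] by (intro add_right_mono mult_left_mono) auto
    also have "Q * sqrt t = q * snd x * t powr (- 1 / 4)"
    proof -
      have "t powr (- 3 / 4) * sqrt t = t powr (- 1 / 4)"
        using t by (simp add: powr_half_sqrt[symmetric] powr_add[symmetric])
      then show ?thesis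
        by (simp add: Q_def mult_ac)
    qed
    \<comment> \<open>\<open>P\<close> contributes \<open>2 q\<close> and \<open>Q\<close> one more
      \<open>q\<close>, hence the coefficient 3.\<close>
    also have "P * (2 * snd x) + q * snd x * t powr (- 1 / 4) = snd x * (2 * p + 3 * q * t powr (- 1 / 4))"
      by (simp add: P_def algebra_simps)
    finally have k_int: "(\<integral>y. indicator {0<..} y * k y \<partial>lborel) \<le> snd x * (2 * p + 3 * q * t powr (- 1 / 4))" .
    have k_bound: "dkernel t (snd x) r * (p + q * r powr (- 1 / 2)) \<le> k r" if r: "r > 0" for r
    proof (cases "r < sqrt t")
      case True
      have "dkernel t (snd x) r * r powr (- 1 / 2) \<le> (snd x * r / t) * r powr (- 1 / 2)"
        using dkernel_le[OF t less_imp_le[OF x], of r] r by (intro mult_right_mono) auto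
      also have "\<dots> = snd x / t * r powr (1 / 2)"
        using r powr_add[of r 1 "- 1 / 2"] by simp
      also have "\<dots> \<le> snd x / t * (sqrt t) powr (1 / 2)"
        using True r x t by (intro mult_left_mono powr_mono2) auto
      also have "\<dots> = snd x * t powr (- 3 / 4)"
        using t powr_add[of t "-1" "1 / 4"]
        by (simp add: powr_half_sqrt[symmetric] powr_powr powr_minus_divide)
      finally have "q * (dkernel t (snd x) r * r powr (- 1 / 2)) \<le> q * (snd x * t powr (- 3 / 4))"
        using q by (intro mult_left_mono)
      moreover have "dkernel t (snd x) r * p \<le> dkernel t (snd x) r * P"
        using q dkernel_nonneg[OF t less_imp_le[OF x] less_imp_le[OF r]] by (intro mult_left_mono) (auto simp: P_def)
      ultimately show ?thesis
        using True r by (simp add: k_def Q_def algebra_simps)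
    next
      case False
      have "r powr (- 1 / 2) \<le> (sqrt t) powr (- 1 / 2)"
        using False r t by (intro powr_mono2') auto
      also have "\<dots> = t powr (- 1 / 4)"
        using t by (simp add: powr_half_sqrt[symmetric] powr_powr)
      finally have "p + q * r powr (- 1 / 2) \<le> P"
        using q by (simp add: P_def mult_left_mono)
      then have "dkernel t (snd x) r * (p + q * r powr (- 1 / 2)) \<le> dkernel t (snd x) r * P"
        using dkernel_nonneg[OF t less_imp_le[OF x] less_imp_le[OF r]] by (intro mult_left_mono)
      then show ?thesis
        using False r by (simp add: k_def mult.commute)
    qed
    let ?e = "\<lambda>y. exp (- (norm (fst x - y))\<^sup>2 / (4 * t))"
    have "\<bar>LINT y|lebesgue_on halfspace. ?e (fst y) * dkernel t (snd x) (snd y) * \<phi> y\<bar>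
        \<le> (LINT y|lebesgue_on halfspace. ?e (fst y) * k (snd y))"
    proof (rule abs_integral_le_integral[OF _ integrable_halfspace_product[OF G(2)[OF t] ik]])
      fix y :: "(real^'n) \<times> real" assume "y \<in> space (lebesgue_on halfspace)"
      then have y: "y \<in> halfspace" and ys: "snd y > 0"
        by (auto simp: halfspace_def)
      have d: "dkernel t (snd x) (snd y) \<ge> 0"
        using t x ys by (intro dkernel_nonneg) auto
      have "\<bar>?e (fst y) * dkernel t (snd x) (snd y) * \<phi> y\<bar> = ?e (fst y) * (dkernel t (snd x) (snd y) * \<bar>\<phi> y\<bar>)"
        using d by (simp add: abs_mult)
      also have "\<dots> \<le> ?e (fst y) * (dkernel t (snd x) (snd y) * (p + q * snd y powr (- 1 / 2)))"
        using d \<phi>[OF y] by (intro mult_left_mono) auto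
      also have "\<dots> \<le> ?e (fst y) * k (snd y)"
        using k_bound[OF ys] by (intro mult_left_mono) auto
      finally show "\<bar>?e (fst y) * dkernel t (snd x) (snd y) * \<phi> y\<bar> \<le> ?e (fst y) * k (snd y)" .
    qed
    also have "\<dots> = G * t powr (CARD('n) / 2) * (\<integral>y. indicator {0<..} y * k y \<partial>lborel)"
      by (rule integral_halfspace_product[OF G(2)[OF t] ik])
    also have "\<dots> \<le> G * t powr (CARD('n) / 2) * (snd x * (2 * p + 3 * q * t powr (- 1 / 4)))"
      using G(1) k_int by (intro mult_left_mono) auto
    finally have "\<bar>S1 t \<phi> x\<bar> \<le> (4 * pi * t) powr (- real DIM((real^'n) \<times> real) / 2) *
        (G * t powr (CARD('n) / 2) * (snd x * (2 * p + 3 * q * t powr (- 1 / 4))))"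
      unfolding S1_def S1_kernel_eq abs_mult by (intro mult_mono) auto
    then show "\<bar>S1 t \<phi> x\<bar> \<le> b * snd x * t powr (- 1 / 2) * (2 * p + 3 * q * t powr (- 1 / 4))"
      unfolding const[OF t] by (simp add: mult_ac)
  qed
  then show ?thesis
    by (rule that)
qed

section \<open>Singular integrals in time and essential bounds\<close>

text \<open>Explicit antiderivatives give gauge integrals; for a nonnegative integrand these are
  absolutely convergent and therefore Lebesgue integrals.\<close>

lemma has_bochner_integral_lebesgue_on_Ioo:
  fixes f :: "real \<Rightarrow> real"
  assumes f: "(f has_integral I) {0..t}" and nonneg: "\<And>s. 0 < s \<Longrightarrow> s < t \<Longrightarrow> 0 \<le> f s"
  shows "has_bochner_integral (lebesgue_on {0<..<t}) f I"
proof -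
  have "(f has_integral I) {0<..<t}"
    using f by (simp add: has_integral_Icc_iff_Ioo)
  then have "set_integrable lebesgue {0<..<t} f" and I: "integral {0<..<t} f = I"
    using nonneg by (auto intro!: nonnegative_absolutely_integrable_1 simp: integrable_on_def)
  then have i: "integrable (lebesgue_on {0<..<t}) f"
    by (simp add: integrable_restrict_space set_integrable_def)
  with lebesgue_integral_eq_integral[OF i] I show ?thesis
    by (simp add: has_bochner_integral_iff)
qed

lemma has_bochner_integral_powr:
  fixes a t :: real
  assumes "0 < t" "a > -1"
  shows has_bochner_integral_powr_left:
      "has_bochner_integral (lebesgue_on {0<..<t}) (\<lambda>s. s powr a) (t powr (a + 1) / (a + 1))"
    and has_bochner_integral_powr_right:
      "has_bochner_integral (lebesgue_on {0<..<t}) (\<lambda>s. (t - s) powr a) (t powr (a + 1) / (a + 1))"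
proof -
  have i: "((\<lambda>s. s powr a) has_integral (t powr (a + 1) / (a + 1))) (cbox 0 t)"
    using has_integral_powr_from_0[OF assms(2), of t] assms(1) by simp
  then show "has_bochner_integral (lebesgue_on {0<..<t}) (\<lambda>s. s powr a) (t powr (a + 1) / (a + 1))"
    by (intro has_bochner_integral_lebesgue_on_Ioo) auto
  have "(\<lambda>s. - s + t) ` {0..t} = {0..t}"
    by (force simp: image_iff intro: bexI[of _ "t - _"])
  then show "has_bochner_integral (lebesgue_on {0<..<t}) (\<lambda>s. (t - s) powr a) (t powr (a + 1) / (a + 1))"
    using has_integral_affinity[OF i, of "- 1" t]
    by (intro has_bochner_integral_lebesgue_on_Ioo) auto
qed

text \<open>
  An elementary substitute for the Beta integral: one of \<open>s\<close>, \<open>t - s\<close> is at least \<open>t / 2\<close>.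
\<close>

definition beta_majorant :: "real \<Rightarrow> real \<Rightarrow> real" where
  "beta_majorant t s = (t / 2) powr (- 1 / 2) * (s powr (- 1 / 2) + (t - s) powr (- 1 / 2))"

lemma beta_majorant_ge:
  assumes "0 < s" "s < t"
  shows "s powr (- 1 / 2) * (t - s) powr (- 1 / 2) \<le> beta_majorant t s"
proof -
  have h: "r powr (- 1 / 2) \<le> (t / 2) powr (- 1 / 2)" if "t / 2 \<le> r" for r :: real
    using that assms by (intro powr_mono2') auto
  show ?thesis
  proof (cases "t / 2 \<le> s")
    case True
    have "s powr (- 1 / 2) * (t - s) powr (- 1 / 2) \<le> (t / 2) powr (- 1 / 2) * (t - s) powr (- 1 / 2)"
      using h[OF True] by (intro mult_right_mono) auto
    then show ?thesis
      by (simp add: beta_majorant_def distrib_left add_increasing)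
  next
    case False
    then have "s powr (- 1 / 2) * (t - s) powr (- 1 / 2) \<le> s powr (- 1 / 2) * (t / 2) powr (- 1 / 2)"
      using h[of "t - s"] by (intro mult_left_mono) auto
    then show ?thesis
      by (simp add: beta_majorant_def distrib_left add_increasing2 mult.commute)
  qed
qed

lemma beta_majorant_integral:
  assumes "0 < t"
  shows integrable_beta_majorant: "integrable (lebesgue_on {0<..<t}) (beta_majorant t)"
    and beta_majorant_integral_le: "integral\<^sup>L (lebesgue_on {0<..<t}) (beta_majorant t) \<le> 6"
proof -
  have "has_bochner_integral (lebesgue_on {0<..<t}) (beta_majorant t)
      ((t / 2) powr (- 1 / 2) * (t powr (- 1 / 2 + 1) / (- 1 / 2 + 1) + t powr (- 1 / 2 + 1) / (- 1 / 2 + 1)))"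
    unfolding beta_majorant_def[abs_def] using assms
    by (intro has_bochner_integral_mult_right has_bochner_integral_add has_bochner_integral_powr) auto
  \<comment> \<open>By scaling the value does not depend on \<open>t\<close>: it is
    \<open>4 * sqrt 2\<close>, rounded up to 6.\<close>
  moreover have "(t / 2) powr (- 1 / 2) * (t powr (- 1 / 2 + 1) / (- 1 / 2 + 1) + t powr (- 1 / 2 + 1) / (- 1 / 2 + 1)) \<le> 6"
  proof -
    have "(t / 2) powr (- 1 / 2) * t powr (1 / 2) = 2 powr (1 / 2)"
      using assms by (simp add: powr_divide powr_minus_divide)
    then have "(t / 2) powr (- 1 / 2) * (t powr (- 1 / 2 + 1) / (- 1 / 2 + 1) + t powr (- 1 / 2 + 1) / (- 1 / 2 + 1)) = 4 * sqrt 2"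
      by (simp add: powr_half_sqrt)
    moreover have "sqrt 2 \<le> 3 / 2"
      by (rule real_le_lsqrt) (auto simp: power2_eq_square)
    ultimately show ?thesis
      by (simp add: mult.commute)
  qed
  ultimately show "integrable (lebesgue_on {0<..<t}) (beta_majorant t)"
    "integral\<^sup>L (lebesgue_on {0<..<t}) (beta_majorant t) \<le> 6"
    by (auto simp: has_bochner_integral_iff)
qed

text \<open>
  Applied with \<open>r = x\<^sub>N\<close> and \<open>s\<close> a time difference, this trades the logarithmic singularity of
  \<open>F\<^sub>2[v]\<close> at the boundary for \<open>x\<^sub>N\<^sup>-\<^sup>1\<^sup>/\<^sup>2\<close>.
\<close>

lemma inverse_add_le_powr:
  fixes r s :: real
  assumes "0 < r" "0 < s"
  shows "1 / (r + s) \<le> r powr (- 1 / 2) * s powr (- 1 / 2)"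
proof -
  have "(r * s) powr (1 / 2) \<le> ((r + s)\<^sup>2) powr (1 / 2)"
    using assms by (intro powr_mono2) (auto simp: power2_eq_square algebra_simps)
  also have "\<dots> = r + s"
    using assms by (simp add: powr_half_sqrt)
  finally have "1 / (r + s) \<le> 1 / (r * s) powr (1 / 2)"
    using assms by (intro divide_left_mono) auto
  then show ?thesis
    using assms by (simp add: powr_mult powr_minus_divide)
qed

section \<open>Essential suprema of continuous functions on the half-space\<close>

lemma open_halfspace: "open (halfspace :: ((real^'n) \<times> real) set)"
  unfolding halfspace_def by (intro open_Times) auto

lemma closure_halfspace: "closure (halfspace :: ((real^'n) \<times> real) set) = UNIV \<times> {0..}"
  unfolding halfspace_def by (simp add: closure_Times)

text \<open>Over a null set the essential supremum of a measurable function would be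
  \<open>- \<infinity>\<close>; a nonempty open set has positive measure. This allows summands in
  \<open>bounded_class\<close> to be dropped.\<close>

lemma Linf_norm_nonneg:
  assumes "open U" "U \<noteq> {}"
  shows "0 \<le> Linf_norm U f"
proof (rule ccontr)
  assume "\<not> 0 \<le> Linf_norm U f"
  then have neg: "Linf_norm U f < 0"
    by simp
  have "AE x in lebesgue_on U. ereal \<bar>f x\<bar> \<le> Linf_norm U f"
    unfolding Linf_norm_def by (rule esssup_AE)
  then have "AE x in lebesgue_on U. False"
  proof (rule eventually_mono)
    show False if "ereal \<bar>f x\<bar> \<le> Linf_norm U f" for x
      using le_less_trans[OF that neg] by simp
  qed
  then have "emeasure (lebesgue_on U) (space (lebesgue_on U)) = 0"
    by (subst (asm) AE_iff_measurable[OF _ refl]) auto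
  moreover have U: "U \<in> sets lebesgue"
    using assms(1) by auto
  ultimately have "emeasure lebesgue U = 0"
    by (simp add: emeasure_restrict_space space_restrict_space)
  then have "negligible U"
    unfolding negligible_iff_null_sets using U by (rule null_setsI)
  then show False
    using open_not_negligible assms by blast
qed

text \<open>The subset of \<open>U\<close> where the bound fails is open and null, hence empty;
  continuity then extends the bound to the closure. In this way an essential bound inside the
  half-space controls the flux on its boundary.\<close>

lemma continuous_le_Linf_norm:
  assumes U: "open U" and f: "continuous_on (closure U) f" and x: "x \<in> closure U"
    and c: "Linf_norm U f \<le> ereal c"
  shows "\<bar>f x\<bar> \<le> c"
proof -
  have "AE x in lebesgue_on U. ereal \<bar>f x\<bar> \<le> Linf_norm U f"
    unfolding Linf_norm_def by (rule esssup_AE)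
  then have AE: "AE x in lebesgue_on U. \<bar>f x\<bar> \<le> c"
  proof (rule eventually_mono)
    show "\<bar>f x\<bar> \<le> c" if "ereal \<bar>f x\<bar> \<le> Linf_norm U f" for x
      using order_trans[OF that c] by simp
  qed
  have U_le: "\<bar>f x\<bar> \<le> c" if "x \<in> U" for x
  proof (rule ccontr)
    assume "\<not> \<bar>f x\<bar> \<le> c"
    let ?V = "U \<inter> (\<lambda>x. \<bar>f x\<bar>) -` {c<..}"
    have "continuous_on U (\<lambda>x. \<bar>f x\<bar>)"
      using f closure_subset by (intro continuous_intros) (rule continuous_on_subset)
    then have "open ?V"
      using U by (intro continuous_open_preimage) auto
    moreover have "x \<in> ?V"
      using that \<open>\<not> \<bar>f x\<bar> \<le> c\<close> by simp
    moreover have "?V \<in> null_sets lebesgue"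
    proof -
      have "AE x in lebesgue. x \<in> U \<longrightarrow> \<bar>f x\<bar> \<le> c"
        using AE U by (simp add: AE_restrict_space_iff)
      then have "AE x in lebesgue. x \<notin> ?V"
        by (auto elim!: eventually_mono)
      moreover have "?V \<in> sets lebesgue"
        using \<open>open ?V\<close> by auto
      ultimately show ?thesis
        by (simp only: AE_iff_null_sets)
    qed
    ultimately show False
      using open_not_negligible[of ?V] unfolding negligible_iff_null_sets by blast
  qed
  have "continuous_on (closure U) (\<lambda>x. \<bar>f x\<bar>)"
    using f by (intro continuous_intros)
  from continuous_le_on_closure[OF this x U_le] show ?thesis .
qed

section \<open>The flux through the boundary\<close>

text \<open>One solution with the data 1 and 0. In the estimates below, \<open>M\<close> is any
  constant for which \<open>M s^(-1/2)\<close> bounds the flux at all times before 1.\<close>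

locale zero_boundary_solution = dirichlet_bounds "TYPE('n::finite)" b for b :: real +
  fixes \<epsilon> A :: real and v w :: "(real^'n) \<times> real \<Rightarrow> real \<Rightarrow> real"
  assumes eps: "0 < \<epsilon>" "\<epsilon> < 1"
    and sol: "global_solution \<epsilon> (\<lambda>_. 1) (\<lambda>_. 0) v w"
    and cls: "bounded_class \<epsilon> v w"
    and A_pos: "A > 0"
    and A: "\<And>a x::real^'n. a > 0 \<Longrightarrow> has_bochner_integral lborel (\<lambda>y. poisson a (x - y)) A"
begin

text \<open>The constant of the Duhamel estimate \<open>v_minus_S1_le\<close>:
  \<open>12 = 2 * 6\<close> comes from the Beta majorant and \<open>72 = 18 * 4\<close> from the
  integral of \<open>(t - s)^(-3/4)\<close>.\<close>

definition \<kappa> :: real where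
  "\<kappa> = b * A * (12 + 72 * (real CARD('n) + 1))"

lemma \<kappa>_pos: "\<kappa> > 0"
  using A_pos b_pos by (simp add: \<kappa>_def add_pos_nonneg)

section \<open>Regularity of the flux and a first bound\<close>

lemma flux_continuous: "continuous_on ({0<..} \<times> UNIV) (\<lambda>(s, y). dnu_bdry v s y)"
proof -
  have "continuous_on (closure halfspace \<times> {0<..}) (\<lambda>(x, t). dnu (\<lambda>z. v z t) x)"
    using sol unfolding global_solution_def by blast
  then have "continuous_on ({0<..} \<times> UNIV) (\<lambda>p. (\<lambda>(x, t). dnu (\<lambda>z. v z t) x) ((snd p, 0), fst p))"
    by (rule continuous_on_compose2) (auto simp: closure_halfspace intro!: continuous_intros)
  then show ?thesis
    by (simp add: dnu_bdry_def case_prod_beta)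
qed

lemma flux_measurable: "s > 0 \<Longrightarrow> dnu_bdry v s \<in> borel_measurable borel"
proof -
  assume "s > 0"
  then have "continuous_on UNIV (\<lambda>y. (\<lambda>(s, y). dnu_bdry v s y) (s, y))"
    by (intro continuous_on_compose2[OF flux_continuous]) (auto intro!: continuous_intros)
  then show ?thesis
    by (simp add: borel_measurable_continuous_onI)
qed

text \<open>A qualitative bound from \<open>bounded_class\<close> on the times before 1.
  \<open>L\<close> may depend on \<epsilon> and on the solution; it only makes the supremum in
  \<open>flux_small\<close> finite.\<close>

lemma flux_bounded:
  obtains L where "\<And>s y. 0 < s \<Longrightarrow> s < 1 \<Longrightarrow> \<bar>dnu_bdry v s y\<bar> \<le> L * s powr (- 1 / 2)"
proof -
  let ?N = "\<lambda>t. Linf_norm halfspace (\<lambda>x. v x t) + ereal (sqrt (t / \<epsilon>)) * Linf_norm halfspace (dnu (\<lambda>x. v x t))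
        + Linf_norm halfspace (\<lambda>x. w x t)"
  define K where "K = (SUP t\<in>{0<..<1}. ?N t)"
  have hs: "open (halfspace :: ((real^'n) \<times> real) set)" "(halfspace :: ((real^'n) \<times> real) set) \<noteq> {}"
    using open_halfspace by (auto simp: halfspace_def)
  note nonneg = Linf_norm_nonneg[OF hs]
  have "K < \<infinity>"
    unfolding K_def by (rule cls[unfolded bounded_class_def, rule_format, OF zero_less_one])
  have le_K: "ereal (sqrt (t / \<epsilon>)) * Linf_norm halfspace (dnu (\<lambda>x. v x t)) \<le> K" if "0 < t" "t < 1" for t
  proof -
    have "ereal (sqrt (t / \<epsilon>)) * Linf_norm halfspace (dnu (\<lambda>x. v x t)) \<le> ?N t"
      using nonneg by (intro add_increasing2[OF nonneg] add_increasing[OF nonneg]) auto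
    also have "\<dots> \<le> K"
      unfolding K_def using that by (intro SUP_upper) auto
    finally show ?thesis .
  qed
  \<comment> \<open>One sample time excludes \<open>K = - \<infinity>\<close>, so that
    \<open>K\<close> is a real number.\<close>
  have "0 \<le> ereal (sqrt (1 / 2 / \<epsilon>)) * Linf_norm halfspace (dnu (\<lambda>x. v x (1 / 2)))"
    using nonneg eps by (intro ereal_0_le_mult) auto
  also have "\<dots> \<le> K"
    by (rule le_K) auto
  finally have "0 \<le> K" .
  with \<open>K < \<infinity>\<close> obtain k where k: "K = ereal k"
    by (cases K) auto
  have "\<bar>dnu_bdry v s y\<bar> \<le> (k * sqrt \<epsilon>) * s powr (- 1 / 2)" if s: "0 < s" "s < 1" for s y
  proof -
    have c: "0 < sqrt (s / \<epsilon>)"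
      using s eps by simp
    have "Linf_norm halfspace (dnu (\<lambda>x. v x s)) \<le> ereal (k / sqrt (s / \<epsilon>))"
      using le_K[OF s] c s eps unfolding k
      by (cases "Linf_norm halfspace (dnu (\<lambda>x. v x s))") (auto simp: field_simps)
    moreover have "continuous_on (closure halfspace) (\<lambda>x. dnu (\<lambda>z. v z s) x)"
    proof -
      have "continuous_on (closure halfspace \<times> {0<..}) (\<lambda>(x, t). dnu (\<lambda>z. v z t) x)"
        using sol unfolding global_solution_def by blast
      then have "continuous_on (closure halfspace) (\<lambda>x. (\<lambda>(x, t). dnu (\<lambda>z. v z t) x) (x, s))"
        by (rule continuous_on_compose2) (use s in \<open>auto intro!: continuous_intros\<close>)
      then show ?thesis
        by simp
    qed
    ultimately have "\<bar>dnu (\<lambda>x. v x s) (y, 0)\<bar> \<le> k / sqrt (s / \<epsilon>)"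
      using hs(1) by (intro continuous_le_Linf_norm) (auto simp: closure_halfspace)
    moreover have "k / sqrt (s / \<epsilon>) = (k * sqrt \<epsilon>) * s powr (- 1 / 2)"
      using s eps by (simp add: real_sqrt_divide powr_minus_divide powr_half_sqrt)
    ultimately show ?thesis
      by (simp add: dnu_bdry_def)
  qed
  then show ?thesis
    by (rule that)
qed

text \<open>The first summand is the instantaneous term with \<open>S2 0\<close>. In the memory term
  the kernel \<open>1 / (x_N + (t - s))\<close> is split by \<open>inverse_add_le_powr\<close>,
  which leaves a Beta integral in time.\<close>

lemma abs_F2_le:
  assumes M: "\<And>s y. 0 < s \<Longrightarrow> s < 1 \<Longrightarrow> \<bar>dnu_bdry v s y\<bar> \<le> M * s powr (- 1 / 2)"
    and x: "snd x > 0" and t: "0 < t" "t < 1"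
  shows "\<bar>F2 v x t\<bar> \<le> A * M * t powr (- 1 / 2) + 6 * (real CARD('n) + 1) * A * M * snd x powr (- 1 / 2)"
proof -
  let ?N = "real CARD('n) + 1"
  let ?c = "?N * A * M * snd x powr (- 1 / 2)"
  have "0 \<le> M * (1 / 2) powr (- 1 / 2)"
    using M[of "1 / 2" 0] by simp
  then have M0: "M \<ge> 0"
    by (simp add: zero_le_mult_iff)
  have c: "?c \<ge> 0"
    using M0 A_pos by simp
  have "\<bar>S2 0 (dnu_bdry v t) x\<bar> \<le> A * (M * t powr (- 1 / 2))"
    using x M[OF t] by (intro abs_S2_le[OF A]) auto
  moreover have "\<bar>LINT s|lebesgue_on {0<..<t}. deriv (\<lambda>r. S2 (r - s) (dnu_bdry v s) x) t\<bar>
      \<le> (LINT s|lebesgue_on {0<..<t}. ?c * beta_majorant t s)"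
  proof (rule abs_integral_le_integral)
    fix s assume "s \<in> space (lebesgue_on {0<..<t})"
    then have s: "0 < s" "s < t" "s < 1"
      using t by auto
    have "\<bar>deriv (\<lambda>r. S2 (r - s) (dnu_bdry v s) x) t\<bar>
        \<le> (CARD('n) + 1) * A * (M * s powr (- 1 / 2)) / (snd x + (t - s))"
      using x s by (intro abs_deriv_S2_le[OF A] flux_measurable M) auto
    also have "\<dots> = ?N * A * M * s powr (- 1 / 2) * (1 / (snd x + (t - s)))"
      by simp
    also have "\<dots> \<le> ?N * A * M * s powr (- 1 / 2) * (snd x powr (- 1 / 2) * (t - s) powr (- 1 / 2))"
      using M0 A_pos x s by (intro mult_left_mono inverse_add_le_powr) auto
    also have "\<dots> = ?c * (s powr (- 1 / 2) * (t - s) powr (- 1 / 2))"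
      by (simp add: mult_ac)
    also have "\<dots> \<le> ?c * beta_majorant t s"
      using c s by (intro mult_left_mono beta_majorant_ge) auto
    finally show "\<bar>deriv (\<lambda>r. S2 (r - s) (dnu_bdry v s) x) t\<bar> \<le> ?c * beta_majorant t s" .
  qed (intro integrable_mult_right integrable_beta_majorant t)
  moreover have "(LINT s|lebesgue_on {0<..<t}. ?c * beta_majorant t s) \<le> ?c * 6"
    using c mult_left_mono[OF beta_majorant_integral_le[OF t(1)] c] by simp
  moreover have "?c * 6 = 6 * ?N * A * M * snd x powr (- 1 / 2)" "A * (M * t powr (- 1 / 2)) = A * M * t powr (- 1 / 2)"
    by simp_all
  ultimately show ?thesis
    unfolding F2_def by linarith
qed

text \<open>The Duhamel term runs at the fast time \<open>(t - s) / \<epsilon>\<close>, and the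
  factor \<open>t^(-1/2)\<close> in \<open>abs_S1_le\<close> turns this into
  \<open>sqrt \<epsilon>\<close>. The remaining singularities in \<open>s\<close> are
  integrable.\<close>

lemma v_minus_S1_le:
  assumes M: "\<And>s y. 0 < s \<Longrightarrow> s < 1 \<Longrightarrow> \<bar>dnu_bdry v s y\<bar> \<le> M * s powr (- 1 / 2)"
    and x: "snd x > 0" and t: "0 < t" "t < 1"
  shows "\<bar>v x t - S1 (t / \<epsilon>) (\<lambda>_. 1) x\<bar> \<le> \<kappa> * sqrt \<epsilon> * M * snd x"
proof -
  let ?N = "real CARD('n) + 1"
  let ?c = "b * snd x * sqrt \<epsilon> * A * M"
  let ?h = "\<lambda>s. ?c * (2 * beta_majorant t s + 18 * ?N * (t - s) powr (- 3 / 4))"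
  have "0 \<le> M * (1 / 2) powr (- 1 / 2)"
    using M[of "1 / 2" 0] by simp
  then have M0: "M \<ge> 0"
    by (simp add: zero_le_mult_iff)
  have c: "?c \<ge> 0"
    using M0 A_pos b_pos x eps by simp
  have S2_0: "S2 r (\<lambda>_. 0) y = 0" for r and y :: "(real^'n) \<times> real"
    by (simp add: S2_def)
  have F1_0: "F1 (\<lambda>_. 0) y s = 0" for s and y :: "(real^'n) \<times> real"
    by (simp add: F1_def S2_0)
  have "v x t = S1 (t / \<epsilon>) (\<lambda>_. 1) x
      - (LINT s|lebesgue_on {0<..<t}. S1 ((t - s) / \<epsilon>) (\<lambda>y. F2 v y s) x)"
  proof -
    have "x \<in> halfspace"
      using x by (simp add: halfspace_def mem_Times_iff)
    then show ?thesis
      using sol t unfolding global_solution_def by (simp add: S2_0 F1_0)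
  qed
  then have "\<bar>v x t - S1 (t / \<epsilon>) (\<lambda>_. 1) x\<bar>
      = \<bar>LINT s|lebesgue_on {0<..<t}. S1 ((t - s) / \<epsilon>) (\<lambda>y. F2 v y s) x\<bar>"
    by simp
  also
  have i: "has_bochner_integral (lebesgue_on {0<..<t}) (\<lambda>s. (t - s) powr (- 3 / 4)) (t powr (- 3 / 4 + 1) / (- 3 / 4 + 1))"
    using t by (intro has_bochner_integral_powr_right) auto
  have "\<bar>LINT s|lebesgue_on {0<..<t}. S1 ((t - s) / \<epsilon>) (\<lambda>y. F2 v y s) x\<bar> \<le> (LINT s|lebesgue_on {0<..<t}. ?h s)"
  proof (rule abs_integral_le_integral)
    show "integrable (lebesgue_on {0<..<t}) ?h"
      using i integrable_beta_majorant[OF t(1)] by (auto simp: has_bochner_integral_iff)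
    fix s assume "s \<in> space (lebesgue_on {0<..<t})"
    then have s: "0 < s" "s < t" "s < 1"
      using t by auto
    have p2: "((t - s) / \<epsilon>) powr (- 1 / 2) = sqrt \<epsilon> * (t - s) powr (- 1 / 2)"
      using s eps by (simp add: powr_divide powr_minus_divide powr_half_sqrt)
    \<comment> \<open>The additional gain \<open>\<epsilon>^(1/4)\<close> is estimated by 1.\<close>
    have "((t - s) / \<epsilon>) powr (- 1 / 4) \<le> (t - s) powr (- 1 / 4)"
      using s eps by (intro powr_mono2') (auto simp: le_divide_eq mult_left_le)
    then have p4: "(t - s) powr (- 1 / 2) * ((t - s) / \<epsilon>) powr (- 1 / 4) \<le> (t - s) powr (- 3 / 4)"
    proof -
      have "(t - s) powr (- 1 / 2) * ((t - s) / \<epsilon>) powr (- 1 / 4)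
          \<le> (t - s) powr (- 1 / 2) * (t - s) powr (- 1 / 4)"
        using \<open>((t - s) / \<epsilon>) powr (- 1 / 4) \<le> (t - s) powr (- 1 / 4)\<close> by (intro mult_left_mono) auto
      also have "\<dots> = (t - s) powr (- 3 / 4)"
        by (simp add: powr_add[symmetric])
      finally show ?thesis .
    qed
    have "\<bar>S1 ((t - s) / \<epsilon>) (\<lambda>y. F2 v y s) x\<bar>
        \<le> b * snd x * ((t - s) / \<epsilon>) powr (- 1 / 2) *
          (2 * (A * M * s powr (- 1 / 2)) + 3 * (6 * ?N * A * M) * ((t - s) / \<epsilon>) powr (- 1 / 4))"
    proof (rule abs_S1_le)
      fix y :: "(real^'n) \<times> real" assume "y \<in> halfspace"
      then show "\<bar>F2 v y s\<bar> \<le> A * M * s powr (- 1 / 2) + 6 * ?N * A * M * snd y powr (- 1 / 2)"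
        using s by (intro abs_F2_le M) (auto simp: halfspace_def)
    qed (use s eps x M0 A_pos in auto)
    also have "\<dots> = ?c * (2 * (s powr (- 1 / 2) * (t - s) powr (- 1 / 2))
        + 18 * ?N * ((t - s) powr (- 1 / 2) * ((t - s) / \<epsilon>) powr (- 1 / 4)))"
      unfolding p2 by (simp add: algebra_simps)
    also have "\<dots> \<le> ?h s"
      using c p4 beta_majorant_ge[OF s(1,2)] by (intro mult_left_mono add_mono) auto
    finally show "\<bar>S1 ((t - s) / \<epsilon>) (\<lambda>y. F2 v y s) x\<bar> \<le> ?h s" .
  qed
  also have "(LINT s|lebesgue_on {0<..<t}. ?h s)
      = ?c * (2 * integral\<^sup>L (lebesgue_on {0<..<t}) (beta_majorant t) + 18 * ?N * (t powr (- 3 / 4 + 1) / (- 3 / 4 + 1)))"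
    using i integrable_beta_majorant[OF t(1)] by (auto simp: has_bochner_integral_iff)
  also have "\<dots> \<le> ?c * (2 * 6 + 18 * ?N * 4)"
  proof -
    have "t powr (1 / 4) \<le> 1 powr (1 / 4)"
      using t by (intro powr_mono2) auto
    then show ?thesis
      using c beta_majorant_integral_le[OF t(1)] by (intro mult_left_mono add_mono) auto
  qed
  also have "\<dots> = \<kappa> * sqrt \<epsilon> * M * snd x"
    by (simp add: \<kappa>_def algebra_simps)
  finally show ?thesis .
qed

text \<open>Near the boundary \<open>v\<close> lies between two linear functions of the height that
  vanish there. Hence \<open>v\<close> vanishes on the boundary, and its difference quotients there
  tend to minus the flux.\<close>

lemma flux_bounds:
  assumes M: "\<And>s y. 0 < s \<Longrightarrow> s < 1 \<Longrightarrow> \<bar>dnu_bdry v s y\<bar> \<le> M * s powr (- 1 / 2)"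
    and t: "0 < t" "t < 1"
  shows "dnu_bdry v t y \<le> \<kappa> * sqrt \<epsilon> * M - 2 * b * exp (- 1 / 4) * sqrt \<epsilon> * t powr (- 1 / 2)"
    and "- dnu_bdry v t y \<le> \<kappa> * sqrt \<epsilon> * M + 2 * b * sqrt \<epsilon> * t powr (- 1 / 2)"
proof -
  let ?f = "\<lambda>r. v (y, r) t"
  let ?E = "\<kappa> * sqrt \<epsilon> * M"
  let ?l = "2 * b * exp (- 1 / 4) * sqrt \<epsilon> * t powr (- 1 / 2)"
  let ?u = "2 * b * sqrt \<epsilon> * t powr (- 1 / 2)"
  have tp: "(t / \<epsilon>) powr (- 1 / 2) = sqrt \<epsilon> * t powr (- 1 / 2)"
    using t eps by (simp add: powr_divide powr_minus_divide powr_half_sqrt)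
  have upper: "?f r \<le> r * (?E + ?u)" if "r > 0" for r
    using v_minus_S1_le[OF M _ t, of "(y, r)"] S1_one_le[of "t / \<epsilon>" "(y, r)"] that t eps
    unfolding tp by (simp add: abs_le_iff algebra_simps)
  have lower: "r * (?l - ?E) \<le> ?f r" if "r > 0" "r\<^sup>2 \<le> t / \<epsilon>" for r
    using v_minus_S1_le[OF M _ t, of "(y, r)"] S1_one_ge[of "t / \<epsilon>" "(y, r)"] that t eps
    unfolding tp by (simp add: abs_le_iff algebra_simps)
  \<comment> \<open>The lower bound for \<open>S1\<close> requires
    \<open>r^2 \<le> t / \<epsilon>\<close>, which holds for all small \<open>r\<close>.\<close>
  have ev: "\<forall>\<^sub>F r in at_right 0. r > 0 \<and> r\<^sup>2 \<le> t / \<epsilon>"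
  proof (rule eventually_at_rightI[of 0 "sqrt (t / \<epsilon>)"])
    show "0 < sqrt (t / \<epsilon>)"
      using t eps by simp
    fix r assume r: "r \<in> {0<..<sqrt (t / \<epsilon>)}"
    then have "r\<^sup>2 \<le> (sqrt (t / \<epsilon>))\<^sup>2"
      by (intro power_mono) auto
    then show "r > 0 \<and> r\<^sup>2 \<le> t / \<epsilon>"
      using r t eps by auto
  qed
  have within: "at (0::real) within {0..} = at_right 0"
    by (simp add: at_within_Ici_at_right)
  have "?f differentiable (at 0 within {0..})"
    using sol t unfolding global_solution_def by (force simp: closure_halfspace)
  then have d: "(?f has_vector_derivative - dnu_bdry v t y) (at_right 0)"
    unfolding vector_derivative_works within by (simp add: dnu_bdry_def dnu_def within)
  \<comment> \<open>The equation for \<open>v\<close> holds only in the open half-space; the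
    boundary value follows by one-sided continuity and squeezing.\<close>
  have f0: "?f 0 = 0"
  proof -
    have "(?f \<longlongrightarrow> ?f 0) (at_right 0)"
      using has_vector_derivative_continuous[OF d] by (simp add: continuous_within)
    moreover have "(?f \<longlongrightarrow> 0) (at_right 0)"
    proof (rule tendsto_sandwich)
      show "\<forall>\<^sub>F r in at_right 0. r * (?l - ?E) \<le> ?f r"
        using ev by eventually_elim (use lower in auto)
      show "\<forall>\<^sub>F r in at_right 0. ?f r \<le> r * (?E + ?u)"
        using ev by eventually_elim (use upper in auto)
      show "((\<lambda>r. r * (?l - ?E)) \<longlongrightarrow> 0) (at_right 0)" "((\<lambda>r. r * (?E + ?u)) \<longlongrightarrow> 0) (at_right 0)"
        by (auto intro!: tendsto_eq_intros)
    qed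
    ultimately show ?thesis
      by (intro tendsto_unique[of "at_right 0"]) auto
  qed
  have q: "((\<lambda>r. ?f r / r) \<longlongrightarrow> - dnu_bdry v t y) (at_right 0)"
    using d f0 by (simp add: has_real_derivative_iff_has_vector_derivative[symmetric] has_field_derivative_iff)
  have "?l - ?E \<le> - dnu_bdry v t y"
    by (rule tendsto_lowerbound[OF q]) (use ev in \<open>eventually_elim\<close>, use lower in \<open>auto simp: field_simps\<close>)
  then show "dnu_bdry v t y \<le> ?E - ?l"
    by simp
  have "- dnu_bdry v t y \<le> ?E + ?u"
    by (rule tendsto_upperbound[OF q]) (use ev in \<open>eventually_elim\<close>, use upper in \<open>auto simp: field_simps\<close>)
  then show "- dnu_bdry v t y \<le> ?E + ?u" .
qed

text \<open>Absorption. \<open>M\<close> is the least admissible constant, and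
  \<open>flux_bounds\<close> applied to it gives \<open>M \<le> M / 8 + 2 b sqrt \<epsilon>\<close>.
  Since \<open>M\<close> is finite, this yields \<open>M \<le> (16 / 7) b sqrt \<epsilon>\<close>,
  rounded up to 4.\<close>

lemma flux_small:
  assumes \<kappa>: "\<kappa> * sqrt \<epsilon> \<le> 1 / 8" and t: "0 < t" "t < 1"
  shows "\<bar>dnu_bdry v t y\<bar> \<le> 4 * b * sqrt \<epsilon> * t powr (- 1 / 2)"
proof -
  define X where "X = {\<bar>dnu_bdry v s y\<bar> * s powr (1 / 2) |s y. 0 < s \<and> s < 1}"
  define M where "M = Sup X"
  have powr_cancel: "s powr (- 1 / 2) * s powr (1 / 2) = 1" if "0 < s" for s :: real
    using that by (simp add: powr_add[symmetric])
  obtain L where L: "\<And>s y. 0 < s \<Longrightarrow> s < 1 \<Longrightarrow> \<bar>dnu_bdry v s y\<bar> \<le> L * s powr (- 1 / 2)"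
    using flux_bounded by blast
  have "r \<le> L" if rX: "r \<in> X" for r
  proof -
    obtain s y where s: "0 < s" "s < 1" and r: "r = \<bar>dnu_bdry v s y\<bar> * s powr (1 / 2)"
      using rX unfolding X_def by blast
    have "r \<le> L * s powr (- 1 / 2) * s powr (1 / 2)"
      unfolding r using L[OF s] by (intro mult_right_mono) auto
    then show ?thesis
      using powr_cancel[OF s(1)] by (simp only: mult.assoc)
  qed
  then have bdd: "bdd_above X"
    by (auto simp: bdd_above_def)
  have M: "\<bar>dnu_bdry v s y\<bar> \<le> M * s powr (- 1 / 2)" if s: "0 < s" "s < 1" for s y
  proof -
    have "\<bar>dnu_bdry v s y\<bar> * s powr (1 / 2) \<le> M"
      unfolding M_def using s by (intro cSup_upper bdd) (auto simp: X_def)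
    then have "\<bar>dnu_bdry v s y\<bar> * s powr (1 / 2) * s powr (- 1 / 2) \<le> M * s powr (- 1 / 2)"
      by (intro mult_right_mono) auto
    then show ?thesis
      using powr_cancel[OF s(1)] by (simp add: mult.assoc mult.commute[of "s powr (1 / 2)"])
  qed
  have "0 \<le> M * (1 / 2) powr (- 1 / 2)"
    using M[of "1 / 2" 0] by simp
  then have M0: "M \<ge> 0"
    by (simp add: zero_le_mult_iff)
  have "M \<le> M / 8 + 2 * b * sqrt \<epsilon>"
    unfolding M_def[symmetric]
  \<comment> \<open>Only the left \<open>M\<close> is unfolded as a supremum; the right one remains
    a fixed constant.\<close>
  proof (subst (1) M_def, rule cSup_least)
    have "\<bar>dnu_bdry v (1 / 2) 0\<bar> * (1 / 2) powr (1 / 2) \<in> X"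
      unfolding X_def by (intro CollectI exI[of _ "1 / 2"] exI[of _ 0]) simp
    then show "X \<noteq> {}"
      by blast
    fix r assume "r \<in> X"
    then obtain s y where s: "0 < s" "s < 1" and r: "r = \<bar>dnu_bdry v s y\<bar> * s powr (1 / 2)"
      unfolding X_def by blast
    have kM: "\<kappa> * sqrt \<epsilon> * M \<le> M / 8"
      using mult_right_mono[OF \<kappa> M0] by simp
    have pos: "0 \<le> 2 * b * exp (- 1 / 4) * sqrt \<epsilon> * s powr (- 1 / 2)" "0 \<le> 2 * b * sqrt \<epsilon> * s powr (- 1 / 2)"
      using b_pos eps by auto
    have "\<bar>dnu_bdry v s y\<bar> \<le> M / 8 + 2 * b * sqrt \<epsilon> * s powr (- 1 / 2)"
      using flux_bounds[OF M s, of y] kM pos by linarith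
    then have "r \<le> (M / 8 + 2 * b * sqrt \<epsilon> * s powr (- 1 / 2)) * s powr (1 / 2)"
      unfolding r by (intro mult_right_mono) auto
    also have "\<dots> = M / 8 * s powr (1 / 2) + 2 * b * sqrt \<epsilon>"
      using powr_cancel[OF s(1)] by (simp add: distrib_right mult.assoc)
    also have "M / 8 * s powr (1 / 2) \<le> M / 8 * 1 powr (1 / 2)"
      using M0 s by (intro mult_left_mono powr_mono2) auto
    finally show "r \<le> M / 8 + 2 * b * sqrt \<epsilon>"
      by simp
  qed
  moreover have "0 \<le> b * sqrt \<epsilon>"
    using b_pos eps by simp
  ultimately have "M \<le> 4 * b * sqrt \<epsilon>"
    by simp
  then have "M * t powr (- 1 / 2) \<le> 4 * b * sqrt \<epsilon> * t powr (- 1 / 2)"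
    by (intro mult_right_mono) auto
  with M[OF t, of y] show ?thesis
    by linarith
qed

text \<open>With \<beta> for \<open>b sqrt \<epsilon>\<close> and \<tau> for
  \<open>t^(-1/2)\<close>, the value \<open>M = 4 \<beta>\<close> from \<open>flux_small\<close>
  makes the error at most \<open>\<beta> / 2 \<le> \<beta> \<tau> / 2\<close>, as
  \<open>t < 1\<close>. The main term is at least \<open>(3/2) \<beta> \<tau>\<close>, since
  \<open>exp (- 1/4) \<ge> 3/4\<close>.\<close>

lemma flux_le:
  assumes \<kappa>: "\<kappa> * sqrt \<epsilon> \<le> 1 / 8" and t: "0 < t" "t < 1"
  shows "dnu_bdry v t y \<le> - b * sqrt \<epsilon> * t powr (- 1 / 2)"
proof -
  let ?\<tau> = "t powr (- 1 / 2)" and ?\<beta> = "b * sqrt \<epsilon>"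
  have \<beta>: "?\<beta> \<ge> 0"
    using b_pos eps by simp
  have "1 powr (- 1 / 2) \<le> ?\<tau>"
    using t by (intro powr_mono2') auto
  then have "?\<beta> * 1 \<le> ?\<beta> * ?\<tau>"
    using \<beta> by (intro mult_left_mono) auto
  moreover have "\<kappa> * sqrt \<epsilon> * (4 * ?\<beta>) \<le> 1 / 8 * (4 * ?\<beta>)"
    using \<kappa> \<beta> by (intro mult_right_mono) auto
  moreover have "3 / 4 * (2 * ?\<beta> * ?\<tau>) \<le> exp (- 1 / 4) * (2 * ?\<beta> * ?\<tau>)"
    using \<beta> exp_ge_add_one_self[of "- 1 / 4"] by (intro mult_right_mono) auto
  moreover have "dnu_bdry v t y \<le> \<kappa> * sqrt \<epsilon> * (4 * ?\<beta>) - exp (- 1 / 4) * (2 * ?\<beta> * ?\<tau>)"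
    using flux_bounds(1)[OF _ t, of "4 * ?\<beta>" y] flux_small[OF \<kappa>] by (simp add: mult_ac)
  ultimately have "dnu_bdry v t y \<le> - (?\<beta> * ?\<tau>)"
    by linarith
  then show ?thesis
    by simp
qed

text \<open>The negative flux enters \<open>w\<close> with a minus sign; \<open>S2\<close> preserves
  its upper bound up to the mass \<open>A\<close>, and \<open>s^(-1/2)\<close> integrates to
  \<open>2 sqrt t\<close>.\<close>

lemma w_ge:
  assumes \<kappa>: "\<kappa> * sqrt \<epsilon> \<le> 1 / 8" and x: "snd x > 0" and t: "0 < t" "t < 1"
  shows "2 * A * b * sqrt \<epsilon> * sqrt t \<le> w x t"
proof -
  let ?h = "\<lambda>s. S2 (t - s) (dnu_bdry v s) x"
  let ?B = "\<lambda>s. 4 * b * sqrt \<epsilon> * s powr (- 1 / 2)"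
  have "x \<in> halfspace"
    using x by (simp add: halfspace_def mem_Times_iff)
  then have w: "w x t = - (LINT s|lebesgue_on {0<..<t}. ?h s)"
    using sol t unfolding global_solution_def by (simp add: S2_def)
  have i: "has_bochner_integral (lebesgue_on {0<..<t}) (\<lambda>s. s powr (- 1 / 2)) (t powr (- 1 / 2 + 1) / (- 1 / 2 + 1))"
    using t by (intro has_bochner_integral_powr_left) auto
  \<comment> \<open>A nonintegrable \<open>?h\<close> would have integral 0 by default and destroy
    the lower bound, so measurability in time has to be proved here.\<close>
  have h_int: "integrable (lebesgue_on {0<..<t}) ?h"
  proof (rule Bochner_Integration.integrable_bound)
    show "integrable (lebesgue_on {0<..<t}) (\<lambda>s. A * ?B s)"
      using i by (auto simp: has_bochner_integral_iff)
    have "\<bar>?h s\<bar> \<le> A * ?B s" if "0 < s" "s < t" for s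
      using that x t flux_small[OF \<kappa>, of s] by (intro abs_S2_le[OF A]) auto
    then show "AE s in lebesgue_on {0<..<t}. norm (?h s) \<le> norm (A * ?B s)"
      by (intro AE_I2) (auto intro: order_trans[OF _ abs_ge_self])
    \<comment> \<open>The integrand extended by 0 outside the time interval is jointly Borel, by
      joint continuity of the flux; integrating out \<open>y\<close> leaves a measurable function of
      time.\<close>
    let ?k = "\<lambda>s y. poisson (snd x + (t - s)) (fst x - y) *
        (indicator ({0<..<t} \<times> UNIV) (s, y) *\<^sub>R (\<lambda>(s, y). dnu_bdry v s y) (s, y))"
    have m1: "(\<lambda>p. indicator ({0<..<t} \<times> UNIV) p *\<^sub>R (\<lambda>(s, y). dnu_bdry v s y) p) \<in> borel_measurable borel"
    proof (rule borel_measurable_continuous_on_indicator)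
      show "{0<..<t} \<times> (UNIV :: (real^'n) set) \<in> sets borel"
        by (intro borel_open open_Times) auto
      show "continuous_on ({0<..<t} \<times> UNIV) (\<lambda>(s, y). dnu_bdry v s y)"
        by (rule continuous_on_subset[OF flux_continuous]) auto
    qed
    have m2: "(\<lambda>p::real \<times> (real^'n). poisson (snd x + (t - fst p)) (fst x - snd p)) \<in> borel_measurable borel"
      unfolding poisson_def borel_prod[symmetric] by measurable
    have "(\<lambda>(s, y). ?k s y) \<in> borel_measurable (lborel \<Otimes>\<^sub>M lborel)"
      unfolding lborel_prod using borel_measurable_times[OF m2 m1] by (simp add: case_prod_unfold)
    then have "(\<lambda>s. \<integral>y. ?k s y \<partial>lborel) \<in> borel_measurable lborel"
      by (rule lborel.borel_measurable_lebesgue_integral)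
    then have "(\<lambda>s. \<integral>y. ?k s y \<partial>lborel) \<in> borel_measurable (lebesgue_on {0<..<t})"
      by (intro measurable_restrict_space1 measurable_completion) simp
    moreover have "(\<integral>y. ?k s y \<partial>lborel) = ?h s" if s: "s \<in> space (lebesgue_on {0<..<t})" for s
    proof -
      have s': "0 < s" "s < t" "s < 1" and a: "snd x + (t - s) > 0"
        using s x t by auto
      have "?h s = (\<integral>y. poisson (snd x + (t - s)) (fst x - y) * dnu_bdry v s y \<partial>lborel)"
        unfolding S2_eq_poisson[OF a]
        by (rule lebesgue_integral_borel(2)[OF poisson_integrable[OF A a flux_measurable[OF s'(1)] flux_small[OF \<kappa> s'(1,3)]]])
      then show ?thesis
        using s' by simp
    qed
    ultimately show "?h \<in> borel_measurable (lebesgue_on {0<..<t})"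
      by (subst measurable_cong[symmetric]) auto
  qed
  have "integral\<^sup>L (lebesgue_on {0<..<t}) ?h \<le> (LINT s|lebesgue_on {0<..<t}. A * (- b * sqrt \<epsilon> * s powr (- 1 / 2)))"
  proof (rule integral_mono[OF h_int])
    show "integrable (lebesgue_on {0<..<t}) (\<lambda>s. A * (- b * sqrt \<epsilon> * s powr (- 1 / 2)))"
      using i by (auto simp: has_bochner_integral_iff)
    fix s assume "s \<in> space (lebesgue_on {0<..<t})"
    then have s: "0 < s" "s < t" "s < 1"
      using t by auto
    then show "?h s \<le> A * (- b * sqrt \<epsilon> * s powr (- 1 / 2))"
      using x by (intro S2_le[OF A _ flux_measurable flux_small[OF \<kappa>] flux_le[OF \<kappa>]]) auto
  qed
  also have "\<dots> = A * (- b * sqrt \<epsilon> * (t powr (- 1 / 2 + 1) / (- 1 / 2 + 1)))"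
    using i by (auto simp: has_bochner_integral_iff)
  also have "\<dots> = - (2 * A * b * sqrt \<epsilon> * sqrt t)"
    using t by (simp add: powr_half_sqrt)
  finally show ?thesis
    unfolding w by simp
qed

text \<open>In \<open>v\<close> the free part is nonnegative, and the Duhamel part is of order
  \<epsilon> by \<open>flux_small\<close>. The constant \<open>\<kappa>\<close> is written out
  because the theorem fixes its threshold before \<open>v\<close> and \<open>w\<close> are
  given.\<close>

lemma solution_ge:
  assumes \<kappa>: "b * A * (12 + 72 * (real CARD('n) + 1)) * sqrt \<epsilon> \<le> 1 / 8"
    and x: "snd x > 0" and t: "0 < t" "t < 1"
  shows "b * sqrt \<epsilon> * (2 * A * sqrt t - 4 * (b * A * (12 + 72 * (real CARD('n) + 1))) * sqrt \<epsilon> * snd x)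
      \<le> v x t + w x t"
proof -
  note \<kappa>' = \<kappa>[folded \<kappa>_def]
  have "- (\<kappa> * sqrt \<epsilon> * (4 * b * sqrt \<epsilon>) * snd x) \<le> v x t"
    using v_minus_S1_le[OF flux_small[OF \<kappa>'] x t] S1_one_nonneg[of "t / \<epsilon>" x] x t eps
    by (auto simp: abs_le_iff)
  moreover have "b * sqrt \<epsilon> * (2 * A * sqrt t - 4 * \<kappa> * sqrt \<epsilon> * snd x)
      = - (\<kappa> * sqrt \<epsilon> * (4 * b * sqrt \<epsilon>) * snd x) + 2 * A * b * sqrt \<epsilon> * sqrt t"
    by (simp add: algebra_simps)
  ultimately show ?thesis
    using w_ge[OF \<kappa>' x t] unfolding \<kappa>_def by linarith
qed

end

section \<open>Constants uniform over a compact set\<close>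

theorem theorem6:
  fixes \<phi>b :: "real^'n \<Rightarrow> real"
  assumes "\<phi>b = (\<lambda>_. 0)"
  shows "\<exists>\<phi> :: (real^'n) \<times> real \<Rightarrow> real. \<phi> \<in> Linf halfspace \<and>
    (\<forall>x0>0. \<exists>\<tau>2>0. \<forall>K :: (((real^'n) \<times> real) \<times> real) set.
       compact K \<and> K \<subseteq> (UNIV \<times> {x0<..}) \<times> {0<..<\<tau>2} \<longrightarrow>
       (\<exists>\<epsilon>0 C. 0 < \<epsilon>0 \<and> \<epsilon>0 \<le> 1 \<and> 0 < C \<and>
         (\<forall>\<epsilon> v w. 0 < \<epsilon> \<and> \<epsilon> < \<epsilon>0 \<and>
            global_solution \<epsilon> \<phi> \<phi>b v w \<and> bounded_class \<epsilon> v w \<longrightarrow>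
            (\<forall>(x, t)\<in>K.
               (v x t + w x t) - S2 t \<phi>b x = v x t + w x t \<and>
               (v x t + w x t) - S2 t \<phi>b x \<ge> C * sqrt \<epsilon>))))"
proof -
  obtain A where A: "A > 0" "\<And>a x::real^'n. a > 0 \<Longrightarrow> has_bochner_integral lborel (\<lambda>y. poisson a (x - y)) A"
    using poisson_mass[where ?'a = "real^'n"] by blast
  obtain b where "dirichlet_bounds TYPE('n) b"
    by (rule S1_bounds)
  then interpret dirichlet_bounds "TYPE('n)" b .
  define \<mu> where "\<mu> = b * A * (12 + 72 * (real CARD('n) + 1))"
  have \<mu>: "\<mu> > 0"
    using A(1) b_pos by (simp add: \<mu>_def add_pos_nonneg)
  have one: "(\<lambda>_. 1) \<in> Linf (halfspace :: ((real^'n) \<times> real) set)"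
  proof -
    have "Linf_norm (halfspace :: ((real^'n) \<times> real) set) (\<lambda>_. 1) \<le> ereal 1"
      unfolding Linf_norm_def by (rule esssup_I) auto
    then have "Linf_norm (halfspace :: ((real^'n) \<times> real) set) (\<lambda>_. 1) < \<infinity>"
      using le_less_trans by fastforce
    then show ?thesis
      by (simp add: Linf_def)
  qed
  have main: "\<exists>\<epsilon>0 C. 0 < \<epsilon>0 \<and> \<epsilon>0 \<le> 1 \<and> 0 < C \<and>
      (\<forall>\<epsilon> v w. 0 < \<epsilon> \<and> \<epsilon> < \<epsilon>0 \<and>
        global_solution \<epsilon> (\<lambda>_. 1) \<phi>b v w \<and> bounded_class \<epsilon> v w \<longrightarrow>
        (\<forall>(x, t)\<in>K. C * sqrt \<epsilon> \<le> v x t + w x t))"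
    if K: "compact K" "K \<subseteq> (UNIV \<times> {x0<..}) \<times> {0<..<1}" and x0: "x0 > 0"
    for K :: "(((real^'n) \<times> real) \<times> real) set" and x0 :: real
  proof (cases "K = {}")
    case True
    then show ?thesis
      by (intro exI[of _ 1]) auto
  next
    case False
    \<comment> \<open>The least time \<open>t0\<close> and the greatest height \<open>R\<close> in
      \<open>K\<close> are all that the constants depend on besides \<open>A\<close> and
      \<open>b\<close>.\<close>
    obtain p where p: "p \<in> K" "\<And>z. z \<in> K \<Longrightarrow> snd p \<le> snd z"
      using continuous_attains_inf[OF K(1) False continuous_on_snd[OF continuous_on_id]] by blast
    obtain q where q: "q \<in> K" "\<And>z. z \<in> K \<Longrightarrow> snd (fst z) \<le> snd (fst q)"
      using continuous_attains_sup[OF K(1) False continuous_on_snd[OF continuous_on_fst[OF continuous_on_id]]] by blast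
    define t0 where "t0 = snd p"
    define R where "R = snd (fst q)"
    have t0: "t0 > 0"
      using p(1) K(2) by (auto simp: t0_def)
    have R: "R > 0"
      using q(1) K(2) x0 by (auto simp: R_def)
    \<comment> \<open>The first entry meets the absorption condition; the second keeps the Duhamel
      error below \<open>A sqrt t0\<close>, half of the main term \<open>2 A sqrt t0\<close>. The
      other half gives \<open>C\<close>.\<close>
    define \<delta> where "\<delta> = min (1 / (8 * \<mu>)) (A * sqrt t0 / (4 * \<mu> * R))"
    have \<delta>: "\<delta> > 0"
      using \<mu> A(1) t0 R by (simp add: \<delta>_def)
    define \<epsilon>0 where "\<epsilon>0 = min 1 (\<delta>\<^sup>2)"
    define C where "C = b * (A * sqrt t0)"
    have "C * sqrt \<epsilon> \<le> v x t + w x t"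
      if \<epsilon>: "0 < \<epsilon>" "\<epsilon> < \<epsilon>0" and sol: "global_solution \<epsilon> (\<lambda>_. 1) \<phi>b v w" "bounded_class \<epsilon> v w"
        and xt: "(x, t) \<in> K" for \<epsilon> v w x t
    proof -
      interpret zero_boundary_solution b \<epsilon> A v w
        using \<epsilon> sol A assms by unfold_locales (auto simp: \<epsilon>0_def)
      have x: "snd x > 0" "snd x \<le> R" and t: "0 < t" "t < 1" "t0 \<le> t"
        using p(2)[OF xt] q(2)[OF xt] xt K(2) x0 by (auto simp: t0_def R_def)
      have "sqrt \<epsilon> \<le> \<delta>"
        using \<epsilon> \<delta> by (intro real_le_lsqrt) (auto simp: \<epsilon>0_def)
      then have s: "sqrt \<epsilon> \<le> 1 / (8 * \<mu>)" "sqrt \<epsilon> \<le> A * sqrt t0 / (4 * \<mu> * R)"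
        by (auto simp: \<delta>_def)
      have 1: "\<mu> * sqrt \<epsilon> \<le> 1 / 8"
        using s(1) \<mu> by (simp add: field_simps)
      have "4 * \<mu> * sqrt \<epsilon> * snd x \<le> 4 * \<mu> * sqrt \<epsilon> * R"
        using x \<mu> \<epsilon> by (intro mult_left_mono) auto
      also have "\<dots> \<le> A * sqrt t0"
        using s(2) \<mu> R by (simp add: field_simps)
      finally have "A * sqrt t0 \<le> 2 * A * sqrt t0 - 4 * \<mu> * sqrt \<epsilon> * snd x"
        by simp
      also have "\<dots> \<le> 2 * A * sqrt t - 4 * \<mu> * sqrt \<epsilon> * snd x"
        using t A_pos by (simp add: mult_left_mono)
      finally have "b * sqrt \<epsilon> * (A * sqrt t0) \<le> b * sqrt \<epsilon> * (2 * A * sqrt t - 4 * \<mu> * sqrt \<epsilon> * snd x)"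
        using b_pos \<epsilon> by (intro mult_left_mono) auto
      also have "\<dots> \<le> v x t + w x t"
        unfolding \<mu>_def by (rule solution_ge[OF 1[unfolded \<mu>_def] x(1) t(1,2)])
      finally show ?thesis
        by (simp add: C_def mult_ac)
    qed
    moreover have "0 < \<epsilon>0" "\<epsilon>0 \<le> 1" "0 < C"
      using \<delta> A(1) b_pos t0 by (auto simp: \<epsilon>0_def C_def)
    ultimately show ?thesis
      by blast
  qed
  have S2_0: "S2 t \<phi>b x = 0" for t and x :: "(real^'n) \<times> real"
    by (simp add: S2_def assms)
  show ?thesis
  proof (intro exI[of _ "\<lambda>_. 1"] conjI one allI impI, goal_cases)
    case (1 x0)
    show ?case
      \<comment> \<open>\<open>\<tau>2 = 1\<close> works for every \<open>x0\<close>, since the flux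
        estimates hold for all times before 1.\<close>
      by (rule exI[of _ 1]) (use main[OF _ _ 1] in \<open>simp add: S2_0\<close>)
  qed
qed

end
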